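(* Let $X\in\mathbb{R}^{m\times n}$ with $\operatorname{rank}(X)=r\le d$. Let $0<p\le 1$ and $p_1,p_2,p_3>0$ satisfy $1/p_1+1/p_2+1/p_3=1/p$. Then, with all minima taken over $U\in\mathbb{R}^{m\times d}$, $V\in\mathbb{R}^{d\times d}$, $W\in\mathbb{R}^{n\times d}$ with $X=UVW^{T}$ (and attained), \[ \|X\|_{S_p}=\min\|U\|_{S_{p_1}}\|V\|_{S_{p_2}}\|W\|_{S_{p_3}} =\min\left(\frac{p_2p_3\|U\|_{S_{p_1}}^{p_1}+p_1p_3\|V\|_{S_{p_2}}^{p_2}+p_1p_2\|W\|_{S_{p_3}}^{p_3}}{p_2p_3+p_1p_3+p_1p_2}\right)^{1/p} =\min\left(\frac{\|U\|_{S_{p_1}}^{p_1}/p_1+\|V\|_{S_{p_2}}^{p_2}/p_2+\|W\|_{S_{p_3}}^{p_3}/p_3}{1/p}\right)^{1/p}. \]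
   Context: For $0<q<\infty$ and a real matrix $Y$ with singular values $\sigma_1(Y),\dots,\sigma_k(Y)$ ($k$ the smaller dimension of $Y$), the Schatten-$q$ (quasi-)norm is $\|Y\|_{S_q}=\left(\sum_{i=1}^{k}\sigma_i(Y)^q\right)^{1/q}$. *)

theory Defs
  imports "Jordan_Normal_Form.Char_Poly" "Jordan_Normal_Form.DL_Rank"
begin

text \<open>Singular values of a real matrix A are the square roots of the eigenvalues of
  A^T A (counted with algebraic multiplicity, i.e. as roots of the characteristic
  polynomial).  Zero singular values contribute 0 to the Schatten sum (q > 0), so summing
  over all eigenvalues of A^T A agrees with summing over the min(m,n) singular values.\<close>

definition schatten :: "real \<Rightarrow> real mat \<Rightarrow> real" where
  "schatten q A =
     (let P = char_poly (transpose_mat A * A)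
      in (\<Sum>e\<in>{e. poly P e = 0}. real (Polynomial.order e P) * (sqrt e) powr q) powr (1 / q))"

end

theory Submission
  imports Defs
begin

text \<open>For \<open>X = U V W\<^sup>T\<close> and \<open>R\<close> the first \<open>k\<close> right singular vectors of \<open>X\<close>, the Gram determinant of
  \<open>X R\<close> is the product of the \<open>k\<close> largest squared singular values of \<open>X\<close>. Multiplying by a matrix
  enlarges a \<open>k \<times> k\<close> Gram determinant at most by the product of its \<open>k\<close> largest squared singular values,
  so peeling off \<open>U\<close>, \<open>V\<close> and \<open>W\<^sup>T\<close> gives Horn's inequality
  \<open>\<Prod>i<k. \<sigma>\<^sub>i(X) \<le> \<Prod>i<k. \<sigma>\<^sub>i(U) \<sigma>\<^sub>i(V) \<sigma>\<^sub>i(W)\<close> for every \<open>k\<close>. By convexity of the exponential and Abel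
  summation this majorization of logarithms bounds the sum of \<open>p\<close>-th powers, and normalising the three
  factors yields the Hoelder inequality for all positive exponents. The weighted AM-GM inequality
  passes to the sum forms, and distributing the singular values of \<open>X\<close> over three factors attains
  all bounds.\<close>

section \<open>Sums of powers under log-majorization\<close>

text \<open>Summation by parts run as an induction: lowering the weight \<open>w k\<close> to
  \<open>w (Suc k)\<close> decreases its product with the partial sum of \<open>e\<close>, since
  that sum is nonnegative.\<close>

lemma abel_sum_ge:
  fixes w e :: "nat \<Rightarrow> real"
  assumes w: "\<And>i j. i \<le> j \<Longrightarrow> j < n \<Longrightarrow> w j \<le> w i"
    and e: "\<And>k. k \<le> n \<Longrightarrow> 0 \<le> (\<Sum>i<k. e i)"
    and k: "k < n"
  shows "w k * (\<Sum>i<Suc k. e i) \<le> (\<Sum>i<Suc k. w i * e i)"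
  using k
proof (induction k)
  case (Suc k)
  have "w (Suc k) * (\<Sum>i<Suc k. e i) \<le> w k * (\<Sum>i<Suc k. e i)"
    by (rule mult_right_mono) (use Suc.prems e[of "Suc k"] w[of k "Suc k"] in auto)
  also have "\<dots> \<le> (\<Sum>i<Suc k. w i * e i)"
    using Suc by simp
  finally show ?case
    by (simp add: distrib_left)
qed simp

text \<open>Single \<open>e i\<close> may be negative; control of the partial sums is exactly what
  majorization of logarithms supplies.\<close>

lemma sum_antimono_weights_nonneg:
  fixes w e :: "nat \<Rightarrow> real"
  assumes w: "\<And>i j. i \<le> j \<Longrightarrow> j < n \<Longrightarrow> w j \<le> w i" and w0: "\<And>i. i < n \<Longrightarrow> 0 \<le> w i"
    and e: "\<And>k. k \<le> n \<Longrightarrow> 0 \<le> (\<Sum>i<k. e i)"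
  shows "0 \<le> (\<Sum>i<n. w i * e i)"
proof (cases n)
  case (Suc k)
  have "0 \<le> w k * (\<Sum>i<Suc k. e i)"
    using e[of n] w0[of k] Suc by simp
  also have "\<dots> \<le> (\<Sum>i<n. w i * e i)"
    unfolding Suc by (rule abel_sum_ge[OF w e]) (use Suc in auto)
  finally show ?thesis .
qed simp

text \<open>The left side is the tangent of the exponential at \<open>ln z\<close>, evaluated at
  \<open>q * ln y\<close>. The bound is \<open>ln t \<le> t - 1\<close> at
  \<open>t = y powr q / z\<close>.\<close>

lemma powr_tangent:
  fixes y z q :: real
  assumes "0 < y" "0 < z"
  shows "z + z * (q * ln y - ln z) \<le> y powr q"
proof -
  have "ln (y powr q / z) \<le> y powr q / z - 1"
    by (rule ln_le_minus_one) (use assms in simp)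
  then have "q * ln y - ln z \<le> y powr q / z - 1"
    using assms by (simp add: ln_div ln_powr)
  then show ?thesis
    using assms by (simp add: field_simps)
qed

text \<open>Each power is bounded below by its tangent at \<open>x i powr p\<close>; Abel summation shows that the
  first-order terms add up to something nonnegative.\<close>

lemma log_majorization_sum:
  fixes x a b c :: "nat \<Rightarrow> real" and p p1 p2 p3 :: real
  assumes x: "\<And>i. i < n \<Longrightarrow> 0 < x i" "\<And>i j. i \<le> j \<Longrightarrow> j < n \<Longrightarrow> x j \<le> x i"
    and pos: "\<And>i. i < n \<Longrightarrow> 0 < a i" "\<And>i. i < n \<Longrightarrow> 0 < b i" "\<And>i. i < n \<Longrightarrow> 0 < c i"
    and maj: "\<And>k. k \<le> n \<Longrightarrow> (\<Prod>i<k. x i) \<le> (\<Prod>i<k. a i * b i * c i)"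
    and p: "0 < p" "0 < p1" "0 < p2" "0 < p3" "1 / p1 + 1 / p2 + 1 / p3 = 1 / p"
  shows "(\<Sum>i<n. x i powr p) / p
    \<le> (\<Sum>i<n. a i powr p1) / p1 + (\<Sum>i<n. b i powr p2) / p2 + (\<Sum>i<n. c i powr p3) / p3"
proof -
  \<comment> \<open>The logarithmic gap: \<open>maj\<close> makes its partial sums nonnegative, and
    the weights \<open>x i powr p\<close> decrease along with \<open>x\<close>.\<close>
  let ?e = "\<lambda>i. ln (a i * b i * c i) - ln (x i)"
  have "0 \<le> (\<Sum>i<n. x i powr p * ?e i)"
  proof (rule sum_antimono_weights_nonneg)
    show "x j powr p \<le> x i powr p" if "i \<le> j" "j < n" for i j
      using that x[of i] x(1)[of j] x(2)[of i j] p by (auto intro!: powr_mono2)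
    show "0 \<le> (\<Sum>i<k. ?e i)" if "k \<le> n" for k
    proof -
      have "ln (\<Prod>i<k. x i) \<le> ln (\<Prod>i<k. a i * b i * c i)"
      proof (rule ln_le_cancel_iff[THEN iffD2, OF _ _ maj[OF that]])
        show "0 < (\<Prod>i<k. x i)" by (rule prod_pos) (use that x(1) in auto)
        show "0 < (\<Prod>i<k. a i * b i * c i)"
          by (rule prod_pos) (use that pos in \<open>auto intro!: mult_pos_pos\<close>)
      qed
      moreover have "ln (\<Prod>i<k. x i) = (\<Sum>i<k. ln (x i))"
        by (rule ln_prod[OF finite_lessThan less_imp_neq[THEN not_sym]]) (use that x(1) in auto)
      moreover have "ln (\<Prod>i<k. a i * b i * c i) = (\<Sum>i<k. ln (a i * b i * c i))"
        by (rule ln_prod[OF finite_lessThan less_imp_neq[THEN not_sym]])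
          (use that pos in \<open>auto intro!: mult_pos_pos\<close>)
      ultimately show ?thesis by (simp add: sum_subtractf)
    qed
  qed auto
  moreover have "x i powr p / p + x i powr p * ?e i
      \<le> a i powr p1 / p1 + b i powr p2 / p2 + c i powr p3 / p3" if i: "i < n" for i
  proof -
    let ?z = "x i powr p"
    note pp = x(1)[OF i] pos[OF i]
    \<comment> \<open>All three tangents touch at the common height \<open>?z\<close>. After
      division by the exponents, the relation between them merges the constant terms into
      \<open>?z / p\<close> and the \<open>ln ?z\<close> terms into \<open>ln (x i)\<close>.\<close>
    have t: "?z / q + ?z * (ln y - ln ?z / q) \<le> y powr q / q" if "0 < q" "0 < y" for y q
      using divide_right_mono[OF powr_tangent[of y ?z q], of q] that pp
      by (simp add: field_simps)
    have "?z * (1 / p1 + 1 / p2 + 1 / p3)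
        + ?z * (ln (a i) + ln (b i) + ln (c i) - ln ?z * (1 / p1 + 1 / p2 + 1 / p3))
      \<le> a i powr p1 / p1 + b i powr p2 / p2 + c i powr p3 / p3"
      using t[OF p(2) pos(1)[OF i]] t[OF p(3) pos(2)[OF i]] t[OF p(4) pos(3)[OF i]]
      by (simp add: algebra_simps)
    moreover have "ln ?z * (1 / p) = ln (x i)"
      using pp p by (simp add: ln_powr)
    moreover have "ln (a i * b i * c i) = ln (a i) + ln (b i) + ln (c i)"
      using pp by (simp add: ln_mult)
    ultimately show ?thesis
      unfolding p(5) by simp
  qed
  then have "(\<Sum>i<n. x i powr p / p + x i powr p * ?e i)
      \<le> (\<Sum>i<n. a i powr p1 / p1 + b i powr p2 / p2 + c i powr p3 / p3)"
    by (intro sum_mono) auto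
  ultimately show ?thesis
    by (simp add: sum.distrib sum_divide_distrib)
qed

text \<open>Homogeneity, as in the classical proof of Hoelder's inequality: scale \<open>a\<close>,
  \<open>b\<close>, \<open>c\<close> to unit norm, where the additive bound has right side
  \<open>1 / p\<close>, and undo the scaling. Majorization survives because each factor on both
  sides is divided by the same \<open>A * B * C\<close>.\<close>

lemma log_majorization_prod:
  fixes x a b c :: "nat \<Rightarrow> real" and p p1 p2 p3 :: real
  assumes x: "\<And>i. i < n \<Longrightarrow> 0 < x i" "\<And>i j. i \<le> j \<Longrightarrow> j < n \<Longrightarrow> x j \<le> x i"
    and pos: "\<And>i. i < n \<Longrightarrow> 0 < a i" "\<And>i. i < n \<Longrightarrow> 0 < b i" "\<And>i. i < n \<Longrightarrow> 0 < c i"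
    and maj: "\<And>k. k \<le> n \<Longrightarrow> (\<Prod>i<k. x i) \<le> (\<Prod>i<k. a i * b i * c i)"
    and p: "0 < p" "0 < p1" "0 < p2" "0 < p3" "1 / p1 + 1 / p2 + 1 / p3 = 1 / p"
  shows "(\<Sum>i<n. x i powr p) powr (1 / p)
    \<le> (\<Sum>i<n. a i powr p1) powr (1 / p1) * (\<Sum>i<n. b i powr p2) powr (1 / p2)
       * (\<Sum>i<n. c i powr p3) powr (1 / p3)"
proof (cases "n = 0")
  case False
  define A where "A = (\<Sum>i<n. a i powr p1) powr (1 / p1)"
  define B where "B = (\<Sum>i<n. b i powr p2) powr (1 / p2)"
  define C where "C = (\<Sum>i<n. c i powr p3) powr (1 / p3)"
  have norm: "0 < (\<Sum>i<n. f i powr q) powr (1 / q)"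
      "(\<Sum>i<n. (f i / (\<Sum>i<n. f i powr q) powr (1 / q)) powr q) = 1"
    if "\<And>i. i < n \<Longrightarrow> 0 < f i" "0 < q" for f :: "nat \<Rightarrow> real" and q
  proof -
    have s: "0 < (\<Sum>i<n. f i powr q)"
      using False that by (intro sum_pos) force+
    then show "0 < (\<Sum>i<n. f i powr q) powr (1 / q)" by simp
    have "(\<Sum>i<n. (f i / (\<Sum>i<n. f i powr q) powr (1 / q)) powr q)
        = (\<Sum>i<n. f i powr q / (\<Sum>i<n. f i powr q))"
      using s that by (intro sum.cong) (auto simp: powr_divide powr_powr less_imp_le)
    then show "(\<Sum>i<n. (f i / (\<Sum>i<n. f i powr q) powr (1 / q)) powr q) = 1"
      using s by (simp flip: sum_divide_distrib)
  qed
  have N: "0 < A" "0 < B" "0 < C"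
    using norm(1) pos p unfolding A_def B_def C_def by blast+
  let ?N = "A * B * C"
  have "(\<Sum>i<n. (x i / ?N) powr p) / p
      \<le> (\<Sum>i<n. (a i / A) powr p1) / p1 + (\<Sum>i<n. (b i / B) powr p2) / p2
        + (\<Sum>i<n. (c i / C) powr p3) / p3"
  proof (rule log_majorization_sum[OF _ _ _ _ _ _ p])
    show "(\<Prod>i<k. x i / ?N) \<le> (\<Prod>i<k. a i / A * (b i / B) * (c i / C))" if "k \<le> n" for k
    proof -
      have "(\<Prod>i<k. x i) / (\<Prod>i<k. ?N) \<le> (\<Prod>i<k. a i * b i * c i) / (\<Prod>i<k. ?N)"
        by (rule divide_right_mono[OF maj[OF that]]) (use N in \<open>auto intro!: prod_nonneg\<close>)
      then show ?thesis
        unfolding prod_dividef[symmetric] by (simp add: mult.assoc)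
    qed
  qed (use x pos N in \<open>auto simp: divide_right_mono\<close>)
  also have "\<dots> = 1 / p"
    using norm(2)[of a p1] norm(2)[of b p2] norm(2)[of c p3] pos p
    unfolding A_def B_def C_def by simp
  finally have "(\<Sum>i<n. (x i / ?N) powr p) \<le> 1"
    using p(1) by (simp add: field_simps)
  moreover have "(\<Sum>i<n. (x i / ?N) powr p) = (\<Sum>i<n. x i powr p) / ?N powr p"
    using N x(1) by (simp add: sum_divide_distrib powr_divide less_imp_le)
  ultimately have "(\<Sum>i<n. x i powr p) \<le> ?N powr p"
    using N by (simp add: divide_le_eq)
  then have "(\<Sum>i<n. x i powr p) powr (1 / p) \<le> (?N powr p) powr (1 / p)"
    using p(1) by (intro powr_mono2) (auto intro!: sum_nonneg)
  also have "\<dots> = ?N"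
    using N p(1) by (simp add: powr_powr)
  finally show ?thesis
    unfolding A_def B_def C_def .
qed simp

section \<open>Gram determinants\<close>

text \<open>Induction that removes the largest element of \<open>S\<close>: among
  \<open>Suc k\<close> naturals the maximum is at least \<open>k\<close>, so its factor is at most
  \<open>l k\<close>.\<close>

lemma prod_antimono_le_initial:
  fixes l :: "nat \<Rightarrow> real"
  assumes l0: "\<And>i. i < d \<Longrightarrow> 0 \<le> l i" and anti: "\<And>i j. i \<le> j \<Longrightarrow> j < d \<Longrightarrow> l j \<le> l i"
    and "S \<subseteq> {..<d}" "card S = k"
  shows "(\<Prod>i\<in>S. l i) \<le> (\<Prod>i<k. l i)"
  using assms(3,4)
proof (induction k arbitrary: S)
  case 0
  then have "S = {}" using finite_subset by fastforce
  then show ?case by simp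
next
  case (Suc k)
  have fin: "finite S" and ne: "S \<noteq> {}"
    using Suc.prems finite_subset by (fastforce, auto)
  define m where "m = Max S"
  have m: "m \<in> S" "\<And>i. i \<in> S \<Longrightarrow> i \<le> m"
    using fin ne by (auto simp: m_def)
  have "S - {m} \<subseteq> {..<m}" using m by (force simp: le_less)
  then have "card (S - {m}) \<le> m"
    by (metis card_lessThan card_mono finite_lessThan)
  then have km: "k \<le> m" using m(1) fin Suc.prems by simp
  have md: "m < d" using m Suc.prems by auto
  have "(\<Prod>i\<in>S. l i) = l m * (\<Prod>i\<in>S - {m}. l i)"
    by (rule prod.remove[OF fin m(1)])
  also have "\<dots> \<le> l k * (\<Prod>i<k. l i)"
    by (rule mult_mono[OF anti[OF km md] Suc.IH])
      (use Suc.prems m(1) fin l0 km md in \<open>auto intro!: prod_nonneg\<close>)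
  finally show ?case by (simp add: mult.commute)
qed

text \<open>A form of the Cauchy--Binet formula that avoids enumerating subsets: expand over all maps
  \<open>f\<close> from row indices of the minor to rows of \<open>C\<close> and average over permutations.\<close>

lemma fact_mult_det_congruence_diag:
  fixes C :: "real mat"
  assumes C: "C \<in> carrier_mat d k"
  shows "fact k * det (transpose_mat C * (mat_diag d l * C))
    = (\<Sum>f | (\<forall>i\<in>{0..<k}. f i \<in> {0..<d}) \<and> (\<forall>i. i \<notin> {0..<k} \<longrightarrow> f i = i).
        (\<Prod>i\<in>{0..<k}. l (f i)) * (det (mat k k (\<lambda>(i, j). C $$ (f i, j))))\<^sup>2)"
proof -
  \<comment> \<open>Fixing \<open>f\<close> outside the row indices makes every map on them occur
    exactly once and keeps the index set finite.\<close>
  let ?F = "{f. (\<forall>i\<in>{0..<k}. f i \<in> {0..<d}) \<and> (\<forall>i. i \<notin> {0..<k} \<longrightarrow> f i = i)}"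
  let ?P = "{p. p permutes {0..<k}}"
  let ?L = "\<lambda>f. \<Prod>i\<in>{0..<k}. l (f i)"
  define D where "D f = mat k k (\<lambda>(i, j). C $$ (f i, j))" for f
  have D: "D f \<in> carrier_mat k k" for f by (simp add: D_def)
  let ?B = "mat_diag d l * C"
  have B: "?B \<in> carrier_mat d k" using C by (simp add: mat_diag_mult_left)
  let ?g = "\<lambda>f. (\<Prod>i\<in>{0..<k}. C $$ (f i, i)) * (?L f * det (D f))"
  have "det (transpose_mat C * ?B)
      = (\<Sum>f\<in>?F. det (mat\<^sub>r k k (\<lambda>i. transpose_mat C $$ (i, f i) \<cdot>\<^sub>v row ?B (f i))))"
    unfolding mat_mul_finsum_alt[OF transpose_carrier_mat[THEN iffD2, OF C] B]
    by (rule det_linear_rows_sum) (use B in auto)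
  also have "\<dots> = (\<Sum>f\<in>?F. ?g f)"
  proof (rule sum.cong[OF refl])
    fix f assume f: "f \<in> ?F"
    have "mat\<^sub>r k k (\<lambda>i. transpose_mat C $$ (i, f i) \<cdot>\<^sub>v row ?B (f i))
        = mat\<^sub>r k k (\<lambda>i. (C $$ (f i, i) * l (f i)) \<cdot>\<^sub>v row C (f i))"
      by (rule eq_matI) (use f C in \<open>auto simp: mat_diag_mult_left\<close>)
    also have "det \<dots> = (\<Prod>i\<in>{0..<k}. C $$ (f i, i) * l (f i)) * det (mat\<^sub>r k k (\<lambda>i. row C (f i)))"
      by (rule det_rows_mul) (use C in auto)
    also have "mat\<^sub>r k k (\<lambda>i. row C (f i)) = D f"
      unfolding D_def by (rule eq_matI) (use f C in auto)
    finally show "det (mat\<^sub>r k k (\<lambda>i. transpose_mat C $$ (i, f i) \<cdot>\<^sub>v row ?B (f i))) = ?g f"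
      by (simp add: prod.distrib mult.assoc)
  qed
  finally have expand: "det (transpose_mat C * ?B) = (\<Sum>f\<in>?F. ?g f)" .
  \<comment> \<open>Passing from \<open>f\<close> to \<open>f \<circ> p\<close> permutes the rows of
    \<open>D f\<close>, which costs \<open>signof p\<close>, and leaves the product of the
    \<open>l (f i)\<close> unchanged.\<close>
  have perm: "(\<Sum>f\<in>?F. ?g f)
      = (\<Sum>f\<in>?F. ?L f * det (D f) * (signof p * (\<Prod>i\<in>{0..<k}. D f $$ (p i, i))))"
    if p: "p permutes {0..<k}" for p
  proof -
    have "(\<Sum>f\<in>?F. ?g f) = (\<Sum>f\<in>?F. ?g (f \<circ> p))"
    proof (rule sum.reindex_bij_witness[of _ "\<lambda>f. f \<circ> p" "\<lambda>f. f \<circ> Hilbert_Choice.inv p"])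
      note pi = permutes_inv[OF p]
      show "f \<circ> Hilbert_Choice.inv p \<circ> p = f" "f \<circ> p \<circ> Hilbert_Choice.inv p = f" for f
        using permutes_inv_o[OF p] by (simp_all add: o_assoc[symmetric])
      show "f \<circ> p \<in> ?F" if "f \<in> ?F" for f
        using that permutes_in_image[OF p] permutes_not_in[OF p] by auto
      show "f \<circ> Hilbert_Choice.inv p \<in> ?F" if "f \<in> ?F" for f
        using that permutes_in_image[OF pi] permutes_not_in[OF pi] by auto
      show "?g (f \<circ> Hilbert_Choice.inv p \<circ> p) = ?g f" for f
        using permutes_inv_o[OF p] by (simp add: o_assoc[symmetric])
    qed
    also have "\<dots> = (\<Sum>f\<in>?F. ?L f * det (D f) * (signof p * (\<Prod>i\<in>{0..<k}. D f $$ (p i, i))))"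
    proof (rule sum.cong[OF refl])
      fix f assume f: "f \<in> ?F"
      have pk: "p i < k" if "i < k" for i
        using permutes_in_image[OF p, of i] that by simp
      have "D (f \<circ> p) = mat k k (\<lambda>(i, j). D f $$ (p i, j))"
        unfolding D_def by (rule eq_matI) (use pk in auto)
      then have "det (D (f \<circ> p)) = signof p * det (D f)"
        using det_permute_rows[OF D p] by simp
      moreover have "?L (f \<circ> p) = ?L f"
        using prod.permute[OF p, of "\<lambda>i. l (f i)"] by (simp add: o_def)
      moreover have "(\<Prod>i\<in>{0..<k}. C $$ ((f \<circ> p) i, i)) = (\<Prod>i\<in>{0..<k}. D f $$ (p i, i))"
        by (rule prod.cong) (use pk in \<open>auto simp: D_def\<close>)
      ultimately show "?g (f \<circ> p) = ?L f * det (D f) * (signof p * (\<Prod>i\<in>{0..<k}. D f $$ (p i, i)))"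
        by simp
    qed
    finally show ?thesis .
  qed
  \<comment> \<open>Adding up the permuted forms of the sum assembles the Leibniz expansion of a
    second factor \<open>det (D f)\<close>; the number of permutations accounts for
    \<open>fact k\<close>.\<close>
  have "fact k * det (transpose_mat C * ?B) = (\<Sum>p\<in>?P. \<Sum>f\<in>?F. ?g f)"
    unfolding expand by (simp add: card_permutations)
  also have "\<dots> = (\<Sum>p\<in>?P. \<Sum>f\<in>?F. ?L f * det (D f) * (signof p * (\<Prod>i\<in>{0..<k}. D f $$ (p i, i))))"
    by (rule sum.cong) (use perm in auto)
  also have "\<dots> = (\<Sum>f\<in>?F. ?L f * det (D f) * (\<Sum>p\<in>?P. signof p * (\<Prod>i\<in>{0..<k}. D f $$ (p i, i))))"
    by (subst sum.swap) (simp add: sum_distrib_left)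
  also have "\<dots> = (\<Sum>f\<in>?F. ?L f * (det (D f))\<^sup>2)"
    by (simp add: det_col[OF D] atLeast0LessThan power2_eq_square mult.assoc)
  finally show ?thesis unfolding D_def .
qed

text \<open>In the expansion over maps \<open>f\<close>, a repeated row makes the minor vanish, so
  only injective \<open>f\<close> count; their weight is a product over a \<open>k\<close>-element
  set. The expansion with constant weight 1 identifies what remains as the Gram determinant of
  \<open>C\<close>.\<close>

lemma det_congruence_diag_le:
  fixes C :: "real mat"
  assumes C: "C \<in> carrier_mat d k"
    and l0: "\<And>i. i < d \<Longrightarrow> 0 \<le> l i" and anti: "\<And>i j. i \<le> j \<Longrightarrow> j < d \<Longrightarrow> l j \<le> l i"
  shows "det (transpose_mat C * (mat_diag d l * C)) \<le> (\<Prod>i<k. l i) * det (transpose_mat C * C)"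
proof -
  let ?F = "{f. (\<forall>i\<in>{0..<k}. f i \<in> {0..<d}) \<and> (\<forall>i. i \<notin> {0..<k} \<longrightarrow> f i = i)}"
  define D where "D f = mat k k (\<lambda>(i, j). C $$ (f i, j))" for f
  have "fact k * det (transpose_mat C * (mat_diag d l * C))
      = (\<Sum>f\<in>?F. (\<Prod>i\<in>{0..<k}. l (f i)) * (det (D f))\<^sup>2)"
    unfolding D_def by (rule fact_mult_det_congruence_diag[OF C])
  also have "\<dots> \<le> (\<Sum>f\<in>?F. (\<Prod>i<k. l i) * (det (D f))\<^sup>2)"
  proof (rule sum_mono)
    fix f assume f: "f \<in> ?F"
    show "(\<Prod>i\<in>{0..<k}. l (f i)) * (det (D f))\<^sup>2 \<le> (\<Prod>i<k. l i) * (det (D f))\<^sup>2"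
    proof (cases "inj_on f {0..<k}")
      case True
      have "(\<Prod>i\<in>{0..<k}. l (f i)) = (\<Prod>i\<in>f ` {0..<k}. l i)"
        by (simp add: prod.reindex[OF True])
      also have "\<dots> \<le> (\<Prod>i<k. l i)"
        by (rule prod_antimono_le_initial[OF l0 anti]) (use f in \<open>auto simp: card_image[OF True]\<close>)
      finally show ?thesis by (rule mult_right_mono) simp
    next
      case False
      then obtain i j where ij: "i < k" "j < k" "i \<noteq> j" "f i = f j"
        unfolding inj_on_def by auto
      have "det (D f) = 0"
        by (rule det_identical_rows[of _ k i j]) (use ij in \<open>auto simp: D_def intro!: eq_vecI\<close>)
      then show ?thesis by simp
    qed
  qed
  also have "\<dots> = (\<Prod>i<k. l i) * (\<Sum>f\<in>?F. (\<Prod>i\<in>{0..<k}. 1) * (det (D f))\<^sup>2)"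
    by (simp add: sum_distrib_left)
  also have "(\<Sum>f\<in>?F. (\<Prod>i\<in>{0..<k}. 1) * (det (D f))\<^sup>2)
      = fact k * det (transpose_mat C * (mat_diag d (\<lambda>i. 1) * C))"
    unfolding D_def using fact_mult_det_congruence_diag[OF C, of "\<lambda>i. 1"] by simp
  also have "mat_diag d (\<lambda>i. 1) * C = C" using C by simp
  finally have "fact k * det (transpose_mat C * (mat_diag d l * C))
      \<le> fact k * ((\<Prod>i<k. l i) * det (transpose_mat C * C))"
    by (simp add: algebra_simps)
  then show ?thesis by (simp add: mult_le_cancel_left_pos)
qed

section \<open>Spectral theorem for real symmetric matrices\<close>

lemma symmetric_scalar_prod:
  fixes A :: "'a :: comm_ring_1 mat"
  assumes A: "A \<in> carrier_mat n n" "transpose_mat A = A"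
    and x: "x \<in> carrier_vec n" and y: "y \<in> carrier_vec n"
  shows "x \<bullet> (A *\<^sub>v y) = (A *\<^sub>v x) \<bullet> y"
  using transpose_vec_mult_scalar[OF A(1) y x] A(2) by simp

lemma scalar_prod_self_eq_sum:
  fixes x :: "real vec"
  assumes "x \<in> carrier_vec n"
  shows "x \<bullet> x = (\<Sum>i<n. (x $ i)\<^sup>2)"
  using assms by (simp add: scalar_prod_def power2_eq_square atLeast0LessThan)

lemma scalar_prod_self_eq_0_iff:
  fixes x :: "real vec"
  assumes x: "x \<in> carrier_vec n"
  shows "x \<bullet> x = 0 \<longleftrightarrow> x = 0\<^sub>v n"
proof
  assume "x \<bullet> x = 0"
  then have "\<forall>i\<in>{..<n}. (x $ i)\<^sup>2 = 0"
    unfolding scalar_prod_self_eq_sum[OF x] by (subst (asm) sum_nonneg_eq_0_iff) auto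
  then show "x = 0\<^sub>v n" using x by (intro eq_vecI) auto
qed simp

lemma scalar_prod_self_nonneg:
  fixes x :: "real vec"
  shows "0 \<le> x \<bullet> x"
  using scalar_prod_self_eq_sum[of x "dim_vec x"] by (simp add: sum_nonneg)

text \<open>A complex eigenvalue exists because the characteristic polynomial splits over the
  complex numbers. Symmetry forces it to be real, and then the real or the imaginary part of its
  eigenvector is a real eigenvector.\<close>

lemma symmetric_real_eigenvalue_exists:
  fixes A :: "real mat"
  assumes A: "A \<in> carrier_mat n n" "transpose_mat A = A" and n: "0 < n"
  shows "\<exists>e. eigenvalue A e"
proof -
  let ?A = "map_mat complex_of_real A"
  have cA: "?A \<in> carrier_mat n n" using A by simp
  obtain as where as: "char_poly ?A = (\<Prod>a\<leftarrow>as. [:- a, 1:])" "length as = n"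
    using char_poly_factorized[OF cA] by blast
  then obtain \<mu> where "\<mu> \<in> set as" using n by (cases as) auto
  then have "poly (char_poly ?A) \<mu> = 0"
    unfolding as(1) by (induction as) auto
  then obtain v where v: "v \<in> carrier_vec n" "v \<noteq> 0\<^sub>v n" "?A *\<^sub>v v = \<mu> \<cdot>\<^sub>v v"
    using eigenvalue_root_char_poly[OF cA] cA unfolding eigenvalue_def eigenvector_def by auto
  define x y where "x = map_vec Re v" and "y = map_vec Im v"
  have xy: "x \<in> carrier_vec n" "y \<in> carrier_vec n" using v by (auto simp: x_def y_def)
  have Av: "(\<Sum>j<n. complex_of_real (A $$ (i, j)) * v $ j) = \<mu> * v $ i" if "i < n" for i
    using arg_cong[OF v(3), of "\<lambda>w. w $ i"] that A(1) v(1)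
    by (simp add: scalar_prod_def atLeast0LessThan)
  have Ax: "A *\<^sub>v x = Re \<mu> \<cdot>\<^sub>v x - Im \<mu> \<cdot>\<^sub>v y"
  proof (rule eq_vecI)
    fix i assume "i < dim_vec (Re \<mu> \<cdot>\<^sub>v x - Im \<mu> \<cdot>\<^sub>v y)"
    then have i: "i < n" using xy by simp
    show "(A *\<^sub>v x) $ i = (Re \<mu> \<cdot>\<^sub>v x - Im \<mu> \<cdot>\<^sub>v y) $ i"
      using arg_cong[OF Av[OF i], of Re] i A(1) v(1)
      by (simp add: scalar_prod_def atLeast0LessThan x_def y_def)
  qed (use A xy in auto)
  have Ay: "A *\<^sub>v y = Im \<mu> \<cdot>\<^sub>v x + Re \<mu> \<cdot>\<^sub>v y"
  proof (rule eq_vecI)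
    fix i assume "i < dim_vec (Im \<mu> \<cdot>\<^sub>v x + Re \<mu> \<cdot>\<^sub>v y)"
    then have i: "i < n" using xy by simp
    show "(A *\<^sub>v y) $ i = (Im \<mu> \<cdot>\<^sub>v x + Re \<mu> \<cdot>\<^sub>v y) $ i"
      using arg_cong[OF Av[OF i], of Im] i A(1) v(1)
      by (simp add: scalar_prod_def atLeast0LessThan x_def y_def)
  qed (use A xy in auto)
  \<comment> \<open>Equate \<open>x \<bullet> (A *\<^sub>v y)\<close> with
    \<open>(A *\<^sub>v x) \<bullet> y\<close>; the terms with \<open>Re \<mu>\<close>
    cancel.\<close>
  have "Im \<mu> * (x \<bullet> x + y \<bullet> y) = 0"
    using symmetric_scalar_prod[OF A xy] xy unfolding Ax Ay
    by (simp add: scalar_prod_add_distrib[of _ n] minus_scalar_prod_distrib[of _ n] algebra_simps)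
  moreover have ne: "x \<noteq> 0\<^sub>v n \<or> y \<noteq> 0\<^sub>v n"
  proof (rule ccontr)
    assume "\<not> ?thesis"
    then have "Re (v $ i) = 0 \<and> Im (v $ i) = 0" if "i < n" for i
      using that v(1) unfolding x_def y_def by (metis carrier_vecD index_map_vec(1) index_zero_vec(1))
    then have "v = 0\<^sub>v n" using v(1) by (intro eq_vecI) (auto simp: complex_eq_iff)
    then show False using v(2) by simp
  qed
  then have "0 < x \<bullet> x + y \<bullet> y"
    using xy scalar_prod_self_eq_0_iff[of x n] scalar_prod_self_eq_0_iff[of y n]
      scalar_prod_self_nonneg[of x] scalar_prod_self_nonneg[of y]
    by linarith
  ultimately have "Im \<mu> = 0" by simp
  then have "A *\<^sub>v x = Re \<mu> \<cdot>\<^sub>v x" "A *\<^sub>v y = Re \<mu> \<cdot>\<^sub>v y"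
    unfolding Ax Ay using xy by auto
  then show ?thesis
    using ne xy A unfolding eigenvalue_def eigenvector_def by auto
qed

text \<open>The reflection along \<open>w = v - e_0\<close> exchanges the unit vectors
  \<open>e_0\<close> and \<open>v\<close>. As \<open>w\<close> has squared length
  \<open>2 * (1 - v $ 0)\<close>, the usual coefficient 2 over that length is
  \<open>c\<close>.\<close>

lemma householder_reflection:
  fixes v :: "real vec"
  assumes v: "v \<in> carrier_vec (Suc n)" "v \<bullet> v = 1"
  obtains H where "H \<in> carrier_mat (Suc n) (Suc n)" "transpose_mat H = H" "H * H = 1\<^sub>m (Suc n)"
    "col H 0 = v"
proof -
  define w where "w i = v $ i - (if i = 0 then 1 else 0)" for i
  text \<open>If \<open>v $ 0 = 1\<close> then \<open>v\<close> is the first basis vector and \<open>c = 0\<close>, so that \<open>H\<close> is the identity.\<close>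
  define c where "c = 1 / (1 - v $ 0)"
  define H where "H = mat (Suc n) (Suc n) (\<lambda>(i, j). (if i = j then 1 else 0) - c * w i * w j)"
  have H: "H \<in> carrier_mat (Suc n) (Suc n)" by (simp add: H_def)
  have vv: "(\<Sum>i<Suc n. v $ i * v $ i) = 1"
    using v by (simp add: scalar_prod_def atLeast0LessThan)
  then have vv': "v $ 0 * v $ 0 + (\<Sum>i<n. v $ Suc i * v $ Suc i) = 1"
    unfolding sum.lessThan_Suc_shift by simp
  have "(\<Sum>i<Suc n. w i * w i) = 2 * (1 - v $ 0)"
    unfolding sum.lessThan_Suc_shift using vv' by (simp add: w_def algebra_simps)
  \<comment> \<open>This form of the normalisation also holds in the degenerate case
    \<open>c = 0\<close>, so \<open>H * H\<close> needs no case distinction.\<close>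
  then have ww: "c * c * (\<Sum>i<Suc n. w i * w i) = 2 * c"
    by (cases "v $ 0 = 1") (simp_all add: c_def nonzero_eq_divide_eq nonzero_divide_eq_eq del: sum.lessThan_Suc)
  have "transpose_mat H = H"
    by (rule eq_matI) (auto simp: H_def)
  moreover have "H * H = 1\<^sub>m (Suc n)"
  proof (rule eq_matI)
    fix i j assume ij: "i < dim_row (1\<^sub>m (Suc n) :: real mat)" "j < dim_col (1\<^sub>m (Suc n) :: real mat)"
    have "(H * H) $$ (i, j) = (\<Sum>k<Suc n. ((if i = k then 1 else 0) - c * w i * w k)
        * ((if k = j then 1 else 0) - c * w k * w j))"
      using ij by (simp add: H_def scalar_prod_def atLeast0LessThan)
    also have "\<dots> = (\<Sum>k<Suc n. (if i = k then (if k = j then 1 else 0) - c * w k * w j else 0)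
        - (if k = j then c * w i * w k else 0) + c * c * (w k * w k) * (w i * w j))"
      by (rule sum.cong) (auto simp: algebra_simps)
    also have "\<dots> = (if i = j then 1 else 0) - c * w i * w j - c * w i * w j
        + c * c * (\<Sum>k<Suc n. w k * w k) * (w i * w j)"
      using ij by (simp add: sum.distrib sum_subtractf sum_distrib_left sum_distrib_right mult.assoc
          sum.delta sum.delta' del: sum.lessThan_Suc)
    also have "\<dots> = (if i = j then 1 else 0)" unfolding ww by simp
    finally show "(H * H) $$ (i, j) = (1\<^sub>m (Suc n)) $$ (i, j)" using ij by simp
  qed (auto simp: H_def)
  moreover have "col H 0 = v"
  proof (rule eq_vecI)
    fix i assume "i < dim_vec v"
    then have i: "i < Suc n" using v by simp
    show "col H 0 $ i = v $ i"
    proof (cases "v $ 0 = 1")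
      case True
      then have "(\<Sum>i<n. v $ Suc i * v $ Suc i) = 0" using vv' by simp
      then have "v $ Suc j = 0" if "j < n" for j
        using that by (subst (asm) sum_nonneg_eq_0_iff) auto
      then show ?thesis using i True by (cases i) (auto simp: H_def c_def)
    next
      case False
      then have "c * w 0 = - 1" by (simp add: c_def w_def field_simps)
      then have "c * w i * w 0 = - w i" by (metis mult.assoc mult.commute mult_minus1)
      then show ?thesis using i by (simp add: H_def w_def)
    qed
  qed (use v in \<open>auto simp: H_def\<close>)
  ultimately show ?thesis using that H by blast
qed

lemma char_poly_orthogonal_diag:
  fixes A :: "'a :: comm_ring_1 mat"
  assumes Q: "Q \<in> carrier_mat n n" "transpose_mat Q * Q = 1\<^sub>m n" "Q * transpose_mat Q = 1\<^sub>m n"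
    and A: "A = Q * mat_diag n l * transpose_mat Q"
  shows "char_poly A = (\<Prod>i<n. [:- l i, 1:])"
proof -
  have "similar_mat A (mat_diag n l)"
    unfolding similar_mat_def similar_mat_wit_def Let_def
    by (rule exI[of _ Q], rule exI[of _ "transpose_mat Q"]) (use assms in auto)
  then have "char_poly A = char_poly (mat_diag n l)"
    by (rule char_poly_similar)
  also have "\<dots> = (\<Prod>a\<leftarrow>diag_mat (mat_diag n l). [:- a, 1:])"
    by (rule char_poly_upper_triangular) (auto simp: mat_diag_def)
  also have "diag_mat (mat_diag n l) = map l [0..<n]"
    by (auto simp: diag_mat_def mat_diag_def)
  also have "(\<Prod>a\<leftarrow>map l [0..<n]. [:- a, 1:]) = (\<Prod>i<n. [:- l i, 1:])"
    by (simp add: prod.list_conv_set_nth atLeast0LessThan)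
  finally show ?thesis .
qed

text \<open>The lifting step of the deflation below: bordering \<open>Q\<close> by a 1 keeps it
  orthogonal, and \<open>case_nat e l\<close> puts the split-off eigenvalue in front of the
  others.\<close>

lemma four_block_similar_orthogonal:
  fixes Q :: "'a :: comm_ring_1 mat"
  assumes Q: "Q \<in> carrier_mat n n" "transpose_mat Q * Q = 1\<^sub>m n"
  defines "P \<equiv> four_block_mat (1\<^sub>m 1) (0\<^sub>m 1 n) (0\<^sub>m n 1) Q"
  shows "P \<in> carrier_mat (Suc n) (Suc n)" "transpose_mat P * P = 1\<^sub>m (Suc n)"
    "P * mat_diag (Suc n) (case_nat e l) * transpose_mat P
      = four_block_mat (mat 1 1 (\<lambda>_. e)) (0\<^sub>m 1 n) (0\<^sub>m n 1) (Q * mat_diag n l * transpose_mat Q)"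
proof -
  show P: "P \<in> carrier_mat (Suc n) (Suc n)"
    using four_block_carrier_mat[of "1\<^sub>m 1" 1 1 Q n n] Q unfolding P_def by simp
  have PT: "transpose_mat P = four_block_mat (1\<^sub>m 1) (0\<^sub>m 1 n) (0\<^sub>m n 1) (transpose_mat Q)"
    unfolding P_def by (subst transpose_four_block_mat[of _ 1 1 _ n _ n]) (use Q in auto)
  show "transpose_mat P * P = 1\<^sub>m (Suc n)"
    unfolding PT unfolding P_def
    by (subst mult_four_block_mat[of _ 1 1 _ n _ n _ _ 1 _ n]) (use Q in auto)
  have D: "mat_diag (Suc n) (case_nat e l)
      = four_block_mat (mat 1 1 (\<lambda>_. e)) (0\<^sub>m 1 n) (0\<^sub>m n 1) (mat_diag n l)"
    by (rule eq_matI) (auto simp: mat_diag_def split: nat.split)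
  have DC: "mat_diag n l \<in> carrier_mat n n" by simp
  have QD: "Q * mat_diag n l \<in> carrier_mat n n" using Q by auto
  have PD: "P * mat_diag (Suc n) (case_nat e l)
      = four_block_mat (mat 1 1 (\<lambda>_. e)) (0\<^sub>m 1 n) (0\<^sub>m n 1) (Q * mat_diag n l)"
    unfolding D unfolding P_def
    by (subst mult_four_block_mat[of _ 1 1 _ n _ n _ _ 1 _ n])
      (use Q DC QD in \<open>auto simp: left_mult_zero_mat[OF DC]\<close>)
  have e: "mat 1 1 (\<lambda>_. e) \<in> carrier_mat 1 1" by simp
  show "P * mat_diag (Suc n) (case_nat e l) * transpose_mat P
      = four_block_mat (mat 1 1 (\<lambda>_. e)) (0\<^sub>m 1 n) (0\<^sub>m n 1) (Q * mat_diag n l * transpose_mat Q)"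
    unfolding PD PT
    by (subst mult_four_block_mat[of _ 1 1 _ n _ n _ _ 1 _ n])
      (use Q DC QD e in \<open>auto simp: right_mult_zero_mat[OF QD] left_add_zero_mat[of _ n n]\<close>)
qed

text \<open>Deflation by induction on the dimension: a reflection moves a unit eigenvector to the
  first basis vector, and the induction hypothesis diagonalises the remaining block.\<close>

lemma real_symmetric_spectral:
  fixes A :: "real mat"
  assumes "A \<in> carrier_mat n n" "transpose_mat A = A"
  shows "\<exists>Q l. Q \<in> carrier_mat n n \<and> transpose_mat Q * Q = 1\<^sub>m n
    \<and> A = Q * mat_diag n l * transpose_mat Q \<and> (\<forall>i j. i \<le> j \<longrightarrow> j < n \<longrightarrow> l j \<le> l i)"
  using assms
proof (induction n arbitrary: A)
  case 0
  then show ?case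
    by (intro exI[of _ "1\<^sub>m 0"] exI[of _ "\<lambda>_. 0"]) auto
next
  case (Suc n)
  note A = Suc.prems
  have cA: "char_poly A \<noteq> 0" using degree_monic_char_poly[OF A(1)] by auto
  let ?E = "{k. poly (char_poly A) k = 0}"
  have E: "finite ?E" "?E \<noteq> {}"
    using poly_roots_finite[OF cA] symmetric_real_eigenvalue_exists[OF A]
      eigenvalue_root_char_poly[OF A(1)] by auto
  \<comment> \<open>Splitting off the largest eigenvalue first is what yields a decreasing
    diagonal.\<close>
  define e where "e = Max ?E"
  have "e \<in> ?E" and max: "\<And>k. k \<in> ?E \<Longrightarrow> k \<le> e"
    using E Max_in Max_ge unfolding e_def by blast+
  then obtain u where u: "u \<in> carrier_vec (Suc n)" "u \<noteq> 0\<^sub>v (Suc n)" "A *\<^sub>v u = e \<cdot>\<^sub>v u"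
    using eigenvalue_root_char_poly[OF A(1)] A(1) unfolding eigenvalue_def eigenvector_def by auto
  have uu: "0 < u \<bullet> u"
    using scalar_prod_self_eq_0_iff[OF u(1)] u(2) scalar_prod_self_nonneg[of u] by linarith
  define v where "v = (1 / sqrt (u \<bullet> u)) \<cdot>\<^sub>v u"
  have v: "v \<in> carrier_vec (Suc n)" "v \<bullet> v = 1" "A *\<^sub>v v = e \<cdot>\<^sub>v v"
    using u uu A(1) unfolding v_def
    by (auto simp: mult_mat_vec smult_smult_assoc mult.commute)
  obtain H where H: "H \<in> carrier_mat (Suc n) (Suc n)" "transpose_mat H = H" "H * H = 1\<^sub>m (Suc n)"
      "col H 0 = v"
    using householder_reflection[OF v(1,2)] by blast
  \<comment> \<open>Since \<open>H\<close> sends the first basis vector to \<open>v\<close> and is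
    an involution, the first column of \<open>A'\<close> is \<open>e\<close> times that basis
    vector; symmetry clears the first row as well.\<close>
  define A' where "A' = H * A * H"
  have A': "A' \<in> carrier_mat (Suc n) (Suc n)" using H A by (simp add: A'_def)
  have sym': "transpose_mat A' = A'"
    unfolding A'_def using H(1,2) A
    by (simp add: transpose_mult[of _ "Suc n" "Suc n" _ "Suc n"]
        assoc_mult_mat[of _ "Suc n" "Suc n" _ "Suc n" _ "Suc n"])
  have "col A' 0 = H *\<^sub>v (A *\<^sub>v v)"
    unfolding A'_def using col_mult2[OF mult_carrier_mat[OF H(1) A(1)] H(1), of 0]
      assoc_mult_mat_vec[OF H(1) A(1) v(1)] H(4)
    by simp
  also have "\<dots> = e \<cdot>\<^sub>v col (H * H) 0"
    unfolding v(3) using col_mult2[OF H(1) H(1), of 0] H(1,4) v(1)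
    by (simp add: mult_mat_vec[of _ "Suc n" "Suc n"])
  finally have col0: "col A' 0 = e \<cdot>\<^sub>v col (1\<^sub>m (Suc n)) 0" by (simp only: H(3))
  have A'0: "A' $$ (i, 0) = (if i = 0 then e else 0)" if "i < Suc n" for i
    using arg_cong[OF col0, of "\<lambda>w. w $ i"] that A' by simp
  have A'0': "A' $$ (0, i) = (if i = 0 then e else 0)" if "i < Suc n" for i
    using A'0[OF that] that A' arg_cong[OF sym', of "\<lambda>M. M $$ (i, 0)"] by simp
  define B where "B = mat n n (\<lambda>(i, j). A' $$ (Suc i, Suc j))"
  have B: "B \<in> carrier_mat n n" by (simp add: B_def)
  have "transpose_mat B = B"
  proof (rule eq_matI)
    fix i j assume "i < dim_row B" "j < dim_col B"
    then show "transpose_mat B $$ (i, j) = B $$ (i, j)"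
      using arg_cong[OF sym', of "\<lambda>M. M $$ (Suc i, Suc j)"] A' by (simp add: B_def)
  qed (auto simp: B_def)
  from Suc.IH[OF B this] obtain Q l where Q: "Q \<in> carrier_mat n n" "transpose_mat Q * Q = 1\<^sub>m n"
      "B = Q * mat_diag n l * transpose_mat Q" and l: "\<And>i j. i \<le> j \<Longrightarrow> j < n \<Longrightarrow> l j \<le> l i"
    by blast
  have A'B: "A' = four_block_mat (mat 1 1 (\<lambda>_. e)) (0\<^sub>m 1 n) (0\<^sub>m n 1) B"
    by (rule eq_matI) (use A' A'0 A'0' in \<open>auto simp: B_def\<close>)
  define P where "P = four_block_mat (1\<^sub>m 1) (0\<^sub>m 1 n) (0\<^sub>m n 1) Q"
  note P = four_block_similar_orthogonal[OF Q(1,2), folded P_def]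
  have A'P: "A' = P * mat_diag (Suc n) (case_nat e l) * transpose_mat P"
    unfolding P(3) A'B Q(3) ..
  let ?D = "mat_diag (Suc n) (case_nat e l)"
  have PT: "transpose_mat P \<in> carrier_mat (Suc n) (Suc n)" using P by simp
  have D: "?D \<in> carrier_mat (Suc n) (Suc n)" by simp
  have HP: "H * P \<in> carrier_mat (Suc n) (Suc n)" "transpose_mat (H * P) = transpose_mat P * H"
    using H P(1) by (auto simp: transpose_mult[of _ "Suc n" "Suc n" _ "Suc n"])
  have "transpose_mat (H * P) * (H * P) = transpose_mat P * (H * H) * P"
    unfolding HP(2) using H(1) P(1) PT by (simp add: assoc_mult_mat[of _ "Suc n" "Suc n" _ "Suc n" _ "Suc n"])
  then have orth: "transpose_mat (H * P) * (H * P) = 1\<^sub>m (Suc n)"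
    unfolding H(3) using P(1,2) PT by simp
  have "A = (H * H) * A * (H * H)" using A(1) unfolding H(3) by simp
  also have "\<dots> = H * A' * H"
    unfolding A'_def using A(1) H(1) by (simp add: assoc_mult_mat[of _ "Suc n" "Suc n" _ "Suc n" _ "Suc n"])
  also have "\<dots> = (H * P) * ?D * transpose_mat (H * P)"
    unfolding A'P HP(2)
    using assoc_mult_mat[OF H(1) mult_carrier_mat[OF P(1) D] PT] assoc_mult_mat[OF H(1) P(1) D]
      assoc_mult_mat[OF mult_carrier_mat[OF HP(1) D] PT H(1)]
    by simp
  finally have decomp: "A = (H * P) * ?D * transpose_mat (H * P)" .
  have HPo: "(H * P) * transpose_mat (H * P) = 1\<^sub>m (Suc n)"
    by (rule mat_mult_left_right_inverse[OF _ HP(1) orth]) (use HP(1) in simp)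
  \<comment> \<open>The decomposition just found factors the characteristic polynomial of
    \<open>A\<close>, so every eigenvalue of the block is also one of \<open>A\<close> and is
    bounded by the maximum \<open>e\<close>.\<close>
  have "l i \<le> e" if "i < n" for i
  proof (rule max)
    show "l i \<in> ?E"
      using that char_poly_orthogonal_diag[OF HP(1) orth HPo decomp]
      by (simp add: poly_prod prod_zero_iff del: prod.lessThan_Suc) (force intro: bexI[of _ "Suc i"])
  qed
  then have "case_nat e l j \<le> case_nat e l i" if "i \<le> j" "j < Suc n" for i j
    using that l by (auto split: nat.split)
  then show ?case
    using HP(1) orth decomp by blast
qed

section \<open>Singular values and Schatten quasi-norms\<close>

lemma order_prod_linear_factors:
  fixes l :: "nat \<Rightarrow> 'a :: idom"
  shows "Polynomial.order e (\<Prod>i<n. [:- l i, 1:]) = card {i. i < n \<and> l i = e}"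
proof (induction n)
  case 0
  then show ?case by (simp add: order_0I)
next
  case (Suc n)
  have ne: "(\<Prod>i<n. [:- l i, 1:]) * [:- l n, 1:] \<noteq> 0"
    by (simp add: prod_zero_iff del: mult_pCons_right)
  have lin: "Polynomial.order e [:- l n, 1:] = (if l n = e then 1 else 0)"
    using order_power_n_n[of e 1] by (auto intro: order_0I)
  have "{i. i < Suc n \<and> l i = e} = {i. i < n \<and> l i = e} \<union> (if l n = e then {n} else {})"
    by (auto simp: less_Suc_eq)
  then have "card {i. i < Suc n \<and> l i = e} = card {i. i < n \<and> l i = e} + (if l n = e then 1 else 0)"
    by (simp add: card_insert_if)
  then show ?case
    unfolding prod.lessThan_Suc order_mult[OF ne] lin Suc.IH by simp
qed

text \<open>The multiplicity of a root counts the positions \<open>i\<close> at which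
  \<open>l i\<close> takes that value, so grouping positions by value turns the sum over distinct
  roots into a sum over positions.\<close>

lemma schatten_eq_sum:
  fixes A Q :: "real mat"
  assumes Q: "Q \<in> carrier_mat n n" "transpose_mat Q * Q = 1\<^sub>m n"
    and A: "transpose_mat A * A = Q * mat_diag n l * transpose_mat Q"
  shows "schatten q A = (\<Sum>i<n. sqrt (l i) powr q) powr (1 / q)"
proof -
  let ?P = "\<Prod>i<n. [:- l i, 1:]"
  have "Q * transpose_mat Q = 1\<^sub>m n"
    by (rule mat_mult_left_right_inverse[OF _ Q(1,2)]) (use Q in simp)
  then have P: "char_poly (transpose_mat A * A) = ?P"
    by (rule char_poly_orthogonal_diag[OF Q _ A])
  have roots: "{e. poly ?P e = 0} = l ` {..<n}"
    by (auto simp: poly_prod prod_zero_iff)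
  have "(\<Sum>e\<in>{e. poly ?P e = 0}. real (Polynomial.order e ?P) * sqrt e powr q)
      = (\<Sum>i<n. sqrt (l i) powr q)"
    unfolding roots order_prod_linear_factors
    using sum_fun_comp[of "{..<n}" "l ` {..<n}" l "\<lambda>e. sqrt e powr q"] by simp
  then show ?thesis unfolding schatten_def P Let_def by simp
qed

text \<open>Two factorisations of the block matrix with rows \<open>x, A\<close> and \<open>B, 1\<close> compute its determinant.\<close>

lemma char_poly_mult_commute:
  fixes A B :: "'a :: idom mat"
  assumes A: "A \<in> carrier_mat m n" and B: "B \<in> carrier_mat n m"
  shows "[:0, 1:] ^ n * char_poly (A * B) = [:0, 1:] ^ m * char_poly (B * A)"
proof -
  let ?x = "[:0, 1:] :: 'a poly"
  let ?c = "map_mat (\<lambda>a. [:a:] :: 'a poly)"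
  define M where "M = four_block_mat (?x \<cdot>\<^sub>m 1\<^sub>m m) (?c A) (?c B) (1\<^sub>m n)"
  \<comment> \<open>Both multipliers clear the lower left block of \<open>M\<close>:
    \<open>L\<close> from the right leaves \<open>A * B\<close>, \<open>L'\<close> from the left
    leaves \<open>B * A\<close> and contributes the extra power of the variable.\<close>
  define L where "L = four_block_mat (1\<^sub>m m) (0\<^sub>m m n) (- ?c B) (1\<^sub>m n)"
  define L' where "L' = four_block_mat (1\<^sub>m m) (0\<^sub>m m n) (- ?c B) (?x \<cdot>\<^sub>m 1\<^sub>m n)"
  have cA: "?c A \<in> carrier_mat m n" and cB: "?c B \<in> carrier_mat n m" using A B by auto
  have carr: "M \<in> carrier_mat (m + n) (m + n)" "L \<in> carrier_mat (m + n) (m + n)"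
      "L' \<in> carrier_mat (m + n) (m + n)"
    unfolding M_def L_def L'_def using cA cB by auto
  have chi: "char_poly_matrix (C * D) = ?x \<cdot>\<^sub>m 1\<^sub>m k + ?c C * (- ?c D)"
    if "C \<in> carrier_mat k j" "D \<in> carrier_mat j k" for C D :: "'a mat" and k j
  proof -
    have "?c C * (- ?c D) = - (?c C * ?c D)"
      using that by (intro uminus_mult_right_mat) auto
    also have "\<dots> = - ?c (C * D)" using map_poly_mult(1)[OF that] by simp
    finally show ?thesis using that unfolding char_poly_matrix_def by (intro eq_matI) auto
  qed
  have "M * L = four_block_mat (char_poly_matrix (A * B)) (?c A) (0\<^sub>m n m) (1\<^sub>m n)"
    unfolding M_def L_def chi[OF A B]
    by (subst mult_four_block_mat[of _ m m _ n _ n _ _ m _ n])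
      (use cA cB in \<open>auto simp: uminus_l_inv_mat intro!: cong_four_block_mat\<close>)
  moreover have "L' * M = four_block_mat (?x \<cdot>\<^sub>m 1\<^sub>m m) (?c A) (0\<^sub>m n m) (char_poly_matrix (B * A))"
    unfolding M_def L'_def chi[OF B A]
    by (subst mult_four_block_mat[of _ m m _ n _ n _ _ m _ n])
      (use cA cB in \<open>auto intro!: cong_four_block_mat\<close>)
  moreover have "det L = 1" "det L' = ?x ^ n"
    unfolding L_def L'_def
    by (subst det_four_block_mat_upper_right_zero[of _ m _ n]; use cB in auto)+
  moreover have "det (four_block_mat (char_poly_matrix (A * B)) (?c A) (0\<^sub>m n m) (1\<^sub>m n)) = char_poly (A * B)"
    unfolding char_poly_def
    by (subst det_four_block_mat_lower_left_zero[of _ m _ n]) (use cA A B in auto)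
  moreover have "det (four_block_mat (?x \<cdot>\<^sub>m 1\<^sub>m m) (?c A) (0\<^sub>m n m) (char_poly_matrix (B * A)))
      = ?x ^ m * char_poly (B * A)"
    unfolding char_poly_def
    by (subst det_four_block_mat_lower_left_zero[of _ m _ n]) (use cA A B in auto)
  ultimately show ?thesis
    using det_mult[OF carr(1,2)] det_mult[OF carr(3,1)] by simp
qed

text \<open>The two characteristic polynomials agree up to powers of the variable, hence in all
  nonzero roots and their orders; the root 0 contributes \<open>0 powr q = 0\<close>.\<close>

lemma schatten_transpose:
  assumes A: "A \<in> carrier_mat m n"
  shows "schatten q (transpose_mat A) = schatten q A"
proof -
  define P P' where "P = char_poly (transpose_mat A * A)" and "P' = char_poly (A * transpose_mat A)"
  have At: "transpose_mat A \<in> carrier_mat n m" using A by simp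
  have PP: "[:0, 1:] ^ n * P' = [:0, 1:] ^ m * P"
    unfolding P_def P'_def by (rule char_poly_mult_commute[OF A At])
  have ne: "P \<noteq> 0" "P' \<noteq> 0"
    using degree_monic_char_poly[OF mult_carrier_mat[OF At A]]
      degree_monic_char_poly[OF mult_carrier_mat[OF A At]] by (auto simp: P_def P'_def)
  have x: "[:0, 1:] ^ k * R \<noteq> 0 \<and> Polynomial.order e ([:0, 1:] ^ k * R) = Polynomial.order e R"
    if "R \<noteq> 0" "e \<noteq> 0" for k and e :: real and R
  proof -
    have 1: "[:0, 1:] ^ k * R \<noteq> 0" using that by simp
    have "Polynomial.order e ([:0, 1:] ^ k) = 0"
      by (rule order_0I) (use that in \<open>simp add: poly_power\<close>)
    then show ?thesis using 1 order_mult[OF 1] by simp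
  qed
  have ord: "Polynomial.order e P' = Polynomial.order e P" if "e \<noteq> 0" for e
    using x[OF ne(1) that, of m] x[OF ne(2) that, of n] PP by simp
  have reduce: "(\<Sum>e\<in>{e. poly R e = 0}. real (Polynomial.order e R) * sqrt e powr q)
      = (\<Sum>e\<in>{e. poly R e = 0} - {0}. real (Polynomial.order e R) * sqrt e powr q)"
    if "R \<noteq> 0" for R
    by (rule sum.mono_neutral_right) (use poly_roots_finite[OF that] in auto)
  have roots: "{e. poly P' e = 0} - {0} = {e. poly P e = 0} - {0}"
    using ord ne by (auto simp: order_root)
  show ?thesis
    unfolding schatten_def Let_def transpose_transpose P_def[symmetric] P'_def[symmetric]
      reduce[OF ne(1)] reduce[OF ne(2)] roots
    by (simp add: ord)
qed

text \<open>This plays the role of the singular value decomposition: \<open>Q\<close> holds the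
  right singular vectors, \<open>l\<close> the squared singular values, and \<open>A * Q\<close> the
  left singular vectors scaled by the singular values. Leaving them unnormalised avoids dividing by
  zero singular values.\<close>

lemma gram_spectral:
  fixes A :: "real mat"
  assumes A: "A \<in> carrier_mat m n"
  obtains Q l where "Q \<in> carrier_mat n n" "transpose_mat Q * Q = 1\<^sub>m n"
    "Q * transpose_mat Q = 1\<^sub>m n"
    "transpose_mat A * A = Q * mat_diag n l * transpose_mat Q"
    "\<And>i j. i < n \<Longrightarrow> j < n \<Longrightarrow> col (A * Q) i \<bullet> col (A * Q) j = (if i = j then l i else 0)"
    "\<And>i. i < n \<Longrightarrow> 0 \<le> l i" "\<And>i j. i \<le> j \<Longrightarrow> j < n \<Longrightarrow> l j \<le> l i"
proof -
  have At: "transpose_mat A \<in> carrier_mat n m" using A by simp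
  have G: "transpose_mat A * A \<in> carrier_mat n n" using mult_carrier_mat[OF At A] .
  have "transpose_mat (transpose_mat A * A) = transpose_mat A * A"
    using transpose_mult[OF At A] by simp
  from real_symmetric_spectral[OF G this] obtain Q l where
    Q: "Q \<in> carrier_mat n n" "transpose_mat Q * Q = 1\<^sub>m n"
      "transpose_mat A * A = Q * mat_diag n l * transpose_mat Q"
    and anti: "\<And>i j. i \<le> j \<Longrightarrow> j < n \<Longrightarrow> l j \<le> l i"
    by blast
  have Qt: "transpose_mat Q \<in> carrier_mat n n" using Q by simp
  have D: "mat_diag n l \<in> carrier_mat n n" by simp
  have Qo: "Q * transpose_mat Q = 1\<^sub>m n"
    by (rule mat_mult_left_right_inverse[OF Qt Q(1,2)])
  have AQ: "A * Q \<in> carrier_mat m n" using A Q by simp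
  have "transpose_mat (A * Q) * (A * Q) = transpose_mat Q * (transpose_mat A * A) * Q"
    using transpose_mult[OF A Q(1)] assoc_mult_mat[OF Qt At AQ] assoc_mult_mat[OF At A Q(1)]
      assoc_mult_mat[OF Qt G Q(1)] by simp
  also have "\<dots> = (transpose_mat Q * Q) * mat_diag n l * (transpose_mat Q * Q)"
    unfolding Q(3)
    using assoc_mult_mat[OF Qt mult_carrier_mat[OF mult_carrier_mat[OF Q(1) D] Qt] Q(1)]
      assoc_mult_mat[OF mult_carrier_mat[OF Q(1) D] Qt Q(1)] assoc_mult_mat[OF Qt Q(1) D]
      assoc_mult_mat[OF Qt mult_carrier_mat[OF Q(1) D] mult_carrier_mat[OF Qt Q(1)]]
    by simp
  also have "\<dots> = mat_diag n l" unfolding Q(2) by (simp add: left_mult_one_mat[OF D] right_mult_one_mat[OF D])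
  finally have gram: "transpose_mat (A * Q) * (A * Q) = mat_diag n l" .
  have cols: "col (A * Q) i \<bullet> col (A * Q) j = (if i = j then l i else 0)" if "i < n" "j < n" for i j
    using arg_cong[OF gram, of "\<lambda>M. M $$ (i, j)"] that AQ by (auto simp: mat_diag_def)
  have "0 \<le> l i" if "i < n" for i
    using cols[OF that that] scalar_prod_self_nonneg[of "col (A * Q) i"] by simp
  then show ?thesis using that[OF Q(1,2) Qo Q(3) cols _ anti] by blast
qed

section \<open>Gram determinants of products, Horn's inequality and rank\<close>

lemma det_gram_mult_le:
  fixes A C Q :: "real mat"
  assumes A: "A \<in> carrier_mat m d" and C: "C \<in> carrier_mat d k"
    and Q: "Q \<in> carrier_mat d d" "Q * transpose_mat Q = 1\<^sub>m d"
    and G: "transpose_mat A * A = Q * mat_diag d l * transpose_mat Q"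
    and l0: "\<And>i. i < d \<Longrightarrow> 0 \<le> l i" and anti: "\<And>i j. i \<le> j \<Longrightarrow> j < d \<Longrightarrow> l j \<le> l i"
  shows "det (transpose_mat (A * C) * (A * C)) \<le> (\<Prod>i<k. l i) * det (transpose_mat C * C)"
proof -
  \<comment> \<open>In the eigenbasis of the Gram matrix of \<open>A\<close>, multiplication by
    \<open>A\<close> becomes a diagonal congruence; the orthogonal change of basis leaves the Gram
    matrix of \<open>C\<close> unchanged.\<close>
  define Y where "Y = transpose_mat Q * C"
  have At: "transpose_mat A \<in> carrier_mat d m" and Ct: "transpose_mat C \<in> carrier_mat k d"
    and Qt: "transpose_mat Q \<in> carrier_mat d d" using A C Q by auto
  have D: "mat_diag d l \<in> carrier_mat d d" by simp
  have AC: "A * C \<in> carrier_mat m k" using A C by simp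
  have Y: "Y \<in> carrier_mat d k" using Qt C by (simp add: Y_def)
  have QD: "Q * mat_diag d l \<in> carrier_mat d d" using Q D by simp
  have Yt: "transpose_mat Y = transpose_mat C * Q"
    unfolding Y_def using transpose_mult[OF Qt C] by simp
  have "transpose_mat (A * C) * (A * C) = transpose_mat C * (transpose_mat A * A * C)"
    using transpose_mult[OF A C] assoc_mult_mat[OF Ct At AC] assoc_mult_mat[OF At A C] by simp
  also have "\<dots> = transpose_mat Y * (mat_diag d l * Y)"
    unfolding G Yt using assoc_mult_mat[OF QD Qt C] assoc_mult_mat[OF Q(1) D Y]
      assoc_mult_mat[OF Ct Q(1) mult_carrier_mat[OF D Y]]
    by (simp add: Y_def)
  also have "det \<dots> \<le> (\<Prod>i<k. l i) * det (transpose_mat Y * Y)"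
    by (rule det_congruence_diag_le[OF Y l0 anti])
  also have "transpose_mat Y * Y = transpose_mat C * C"
    unfolding Yt using assoc_mult_mat[OF Ct Q(1) Y] assoc_mult_mat[OF Q(1) Qt C] Q(2) C
    by (simp add: Y_def)
  finally show ?thesis .
qed

lemma gram_initial_columns:
  fixes X Q :: "real mat"
  assumes X: "X \<in> carrier_mat m n" and Q: "Q \<in> carrier_mat n n"
    and cols: "\<And>i j. i < n \<Longrightarrow> j < n \<Longrightarrow> col (X * Q) i \<bullet> col (X * Q) j = (if i = j then l i else 0)"
    and k: "k \<le> n"
  defines "R \<equiv> mat n k (\<lambda>(i, j). Q $$ (i, j))"
  shows "transpose_mat (X * R) * (X * R) = mat_diag k l"
proof (rule eq_matI)
  have R: "R \<in> carrier_mat n k" by (simp add: R_def)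
  have "col (X * R) i = col (X * Q) i" if "i < k" for i
  proof -
    have "col R i = col Q i"
      by (rule eq_vecI) (use that Q k in \<open>auto simp: R_def\<close>)
    then show ?thesis
      using col_mult2[OF X R that] col_mult2[OF X Q, of i] that k by simp
  qed
  then show "(transpose_mat (X * R) * (X * R)) $$ (i, j) = mat_diag k l $$ (i, j)"
    if "i < dim_row (mat_diag k l)" "j < dim_col (mat_diag k l)" for i j
    using that cols[of i j] R X k by (auto simp: mat_diag_def)
qed (auto simp: R_def mat_diag_def)

text \<open>Horn's inequality in squared form: \<open>x\<close>, \<open>u\<close>, \<open>v\<close>,
  \<open>w\<close> are squares of singular values. The factor applied to \<open>R\<close> is
  \<open>transpose_mat W\<close>, whose Gram matrix is \<open>W * transpose_mat W\<close>.\<close>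

lemma singular_values_prod_le:
  fixes X U V W :: "real mat"
  assumes carr: "X \<in> carrier_mat m n" "U \<in> carrier_mat m d" "V \<in> carrier_mat d d" "W \<in> carrier_mat n d"
    and fac: "X = U * V * transpose_mat W"
    and X: "Q \<in> carrier_mat n n" "transpose_mat Q * Q = 1\<^sub>m n"
      "\<And>i j. i < n \<Longrightarrow> j < n \<Longrightarrow> col (X * Q) i \<bullet> col (X * Q) j = (if i = j then x i else 0)"
    and U: "QU \<in> carrier_mat d d" "QU * transpose_mat QU = 1\<^sub>m d"
      "transpose_mat U * U = QU * mat_diag d u * transpose_mat QU"
      "\<And>i. i < d \<Longrightarrow> 0 \<le> u i" "\<And>i j. i \<le> j \<Longrightarrow> j < d \<Longrightarrow> u j \<le> u i"
    and V: "QV \<in> carrier_mat d d" "QV * transpose_mat QV = 1\<^sub>m d"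
      "transpose_mat V * V = QV * mat_diag d v * transpose_mat QV"
      "\<And>i. i < d \<Longrightarrow> 0 \<le> v i" "\<And>i j. i \<le> j \<Longrightarrow> j < d \<Longrightarrow> v j \<le> v i"
    and W: "QW \<in> carrier_mat n n" "QW * transpose_mat QW = 1\<^sub>m n"
      "W * transpose_mat W = QW * mat_diag n w * transpose_mat QW"
      "\<And>i. i < n \<Longrightarrow> 0 \<le> w i" "\<And>i j. i \<le> j \<Longrightarrow> j < n \<Longrightarrow> w j \<le> w i"
    and k: "k \<le> n" "k \<le> d"
  shows "(\<Prod>i<k. x i) \<le> (\<Prod>i<k. u i * v i * w i)"
proof -
  define R where "R = mat n k (\<lambda>(i, j). Q $$ (i, j))"
  have R: "R \<in> carrier_mat n k" by (simp add: R_def)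
  have Wt: "transpose_mat W \<in> carrier_mat d n" using carr by simp
  define Y where "Y = transpose_mat W * R"
  have Y: "Y \<in> carrier_mat d k" using Wt R by (simp add: Y_def)
  have VY: "V * Y \<in> carrier_mat d k" using carr Y by simp
  have XR: "X * R = U * (V * Y)"
    unfolding fac Y_def
    using assoc_mult_mat[OF mult_carrier_mat[OF carr(2,3)] Wt R]
      assoc_mult_mat[OF carr(2,3) Y[unfolded Y_def]] by simp
  have det_diag: "det (mat_diag k l) = (\<Prod>i<k. l i)" for l :: "nat \<Rightarrow> real"
    by (subst det_upper_triangular[of _ k])
      (auto simp: mat_diag_def diag_mat_def prod.list_conv_set_nth atLeast0LessThan)
  have I: "1\<^sub>m n * Q = Q" using X(1) by simp
  have "col (1\<^sub>m n * Q) i \<bullet> col (1\<^sub>m n * Q) j = (if i = j then 1 else 0)" if "i < n" "j < n" for i j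
    unfolding I using arg_cong[OF X(2), of "\<lambda>M. M $$ (i, j)"] that X(1) by simp
  \<comment> \<open>With the identity in place of \<open>X\<close>, the truncation lemma says that
    the columns of \<open>R\<close> are orthonormal, so the last determinant of the chain is
    1.\<close>
  from gram_initial_columns[OF one_carrier_mat X(1) this k(1), folded R_def]
  have RR: "transpose_mat R * R = 1\<^sub>m k"
    using R by simp
  have XX: "transpose_mat (X * R) * (X * R) = mat_diag k x"
    unfolding R_def by (rule gram_initial_columns[OF carr(1) X(1,3) k(1)])
  have "(\<Prod>i<k. x i) = det (transpose_mat (X * R) * (X * R))"
    by (simp only: XX det_diag)
  also have "\<dots> \<le> (\<Prod>i<k. u i) * det (transpose_mat (V * Y) * (V * Y))"
    unfolding XR by (rule det_gram_mult_le[OF carr(2) VY U])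
  also have "\<dots> \<le> (\<Prod>i<k. u i) * ((\<Prod>i<k. v i) * det (transpose_mat Y * Y))"
    by (intro mult_left_mono det_gram_mult_le[OF carr(3) Y V] prod_nonneg) (use U(4) k in auto)
  also have "\<dots> \<le> (\<Prod>i<k. u i) * ((\<Prod>i<k. v i) * ((\<Prod>i<k. w i) * det (transpose_mat R * R)))"
    unfolding Y_def
    by (intro mult_left_mono det_gram_mult_le[OF Wt R W(1,2) _ W(4,5)] prod_nonneg)
      (use U(4) V(4) W(3) k in auto)
  finally show ?thesis
    unfolding RR by (simp add: prod.distrib mult.assoc)
qed

text \<open>The first \<open>k\<close> columns of \<open>X * Q\<close> lie in the column space of
  \<open>X\<close> and are nonzero and pairwise orthogonal, hence independent.\<close>

lemma positive_singular_values_le_rank: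
  fixes X Q :: "real mat"
  assumes X: "X \<in> carrier_mat m n" and Q: "Q \<in> carrier_mat n n"
    and cols: "\<And>i j. i < n \<Longrightarrow> j < n \<Longrightarrow> col (X * Q) i \<bullet> col (X * Q) j = (if i = j then l i else 0)"
    and k: "k \<le> n" and pos: "\<And>i. i < k \<Longrightarrow> 0 < l i"
  shows "k \<le> vec_space.rank m X"
proof -
  interpret vec_space "TYPE(real)" m .
  define R where "R = mat n k (\<lambda>(i, j). Q $$ (i, j))"
  have R: "R \<in> carrier_mat n k" by (simp add: R_def)
  define Y where "Y = X * R"
  have Y: "Y \<in> carrier_mat m k" using X R by (simp add: Y_def)
  have gram: "transpose_mat Y * Y = mat_diag k l"
    unfolding Y_def R_def by (rule gram_initial_columns[OF X Q cols k])
  have inner: "col Y i \<bullet> col Y j = (if i = j then l i else 0)" if "i < k" "j < k" for i j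
    using arg_cong[OF gram, of "\<lambda>M. M $$ (i, j)"] that Y by (auto simp: mat_diag_def)
  \<comment> \<open>Independence speaks of the set of columns; distinctness ensures that this set
    has \<open>k\<close> elements.\<close>
  have dist: "distinct (Matrix.cols Y)"
  proof (unfold distinct_conv_nth, intro allI impI)
    fix i j assume ij: "i < length (Matrix.cols Y)" "j < length (Matrix.cols Y)" "i \<noteq> j"
    then have ij': "i < k" "j < k" using Y by auto
    show "Matrix.cols Y ! i \<noteq> Matrix.cols Y ! j"
      using inner[OF ij'(1) ij'(1)] inner[OF ij'] pos[OF ij'(1)] ij by auto
  qed
  have indep: "lin_indpt (set (Matrix.cols Y))"
  proof
    assume "lin_dep (set (Matrix.cols Y))"
    then obtain v where v: "v \<in> carrier_vec k" "v \<noteq> 0\<^sub>v k" "Y *\<^sub>v v = 0\<^sub>v m"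
      using lin_depE[OF Y _ dist] by blast
    \<comment> \<open>A linear relation between the columns is multiplied by
      \<open>transpose_mat Y\<close>, giving \<open>l i * v $ i = 0\<close> with positive
      \<open>l i\<close>.\<close>
    have "mat_diag k l *\<^sub>v v = transpose_mat Y *\<^sub>v (Y *\<^sub>v v)"
      unfolding gram[symmetric] by (rule assoc_mult_mat_vec) (use Y v in auto)
    then have z: "mat_diag k l *\<^sub>v v = 0\<^sub>v k" using v(3) Y by auto
    have "v $ i = 0" if i: "i < k" for i
    proof -
      have "(mat_diag k l *\<^sub>v v) $ i = (\<Sum>j<k. (if i = j then l j else 0) * v $ j)"
        using i v(1) by (simp add: mat_diag_def scalar_prod_def atLeast0LessThan)
      also have "\<dots> = (\<Sum>j<k. if j = i then l j * v $ j else 0)"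
        by (rule sum.cong) auto
      also have "\<dots> = l i * v $ i" using i by simp
      finally show ?thesis using pos[OF i] i unfolding z by simp
    qed
    then show False using v by (metis carrier_vecD eq_vecI index_zero_vec)
  qed
  have "col Y j \<in> col_space X" if "j < k" for j
    unfolding col_space_eq[OF X] using X R that col_mult2[OF X R that]
    by (auto simp: Y_def intro!: bexI[of _ "col R j"])
  then have sub: "set (Matrix.cols Y) \<subseteq> span (set (Matrix.cols X))"
    using Y unfolding col_space_def[symmetric] by (auto simp: cols_def)
  have XC: "set (Matrix.cols X) \<subseteq> carrier_vec m" using X cols_dim by blast
  have sm: "submodule class_ring (span (set (Matrix.cols X))) V"
    using span_is_submodule XC by simp
  have vs: "vectorspace class_ring (span_vs (set (Matrix.cols X)))"
    using span_is_subspace[of "set (Matrix.cols X)"] XC subspace_is_vs by simp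
  have "card (set (Matrix.cols Y)) \<le> rank X"
    unfolding rank_def
    by (rule vectorspace.li_le_dim(2)[OF vs])
      (use sub indep span_li_not_depend(2)[OF sub sm] fin_dim_span_cols[OF X] in auto)
  then show ?thesis
    using distinct_card[OF dist] Y by simp
qed

section \<open>Hoelder's inequality for Schatten quasi-norms and weighted AM-GM\<close>

lemma antimono_nonneg_support:
  fixes l :: "nat \<Rightarrow> real"
  assumes "\<And>i. i < n \<Longrightarrow> 0 \<le> l i" "\<And>i j. i \<le> j \<Longrightarrow> j < n \<Longrightarrow> l j \<le> l i"
  obtains k where "k \<le> n" "\<And>i. i < k \<Longrightarrow> 0 < l i" "\<And>i. k \<le> i \<Longrightarrow> i < n \<Longrightarrow> l i = 0"
proof
  let ?P = "\<lambda>i. n \<le> i \<or> l i \<le> 0"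
  define k where "k = (LEAST i. ?P i)"
  have k: "?P k" unfolding k_def by (rule LeastI[of _ n]) simp
  show "k \<le> n" unfolding k_def by (rule Least_le) simp
  show "0 < l i" if "i < k" for i
    using not_less_Least[OF that[unfolded k_def]] by simp
  show "l i = 0" if "k \<le> i" "i < n" for i
    using k that assms(1)[of i] assms(2)[of k i] by auto
qed

lemma schatten_nonneg: "0 \<le> schatten q A"
  by (simp add: schatten_def Let_def)

lemma sqrt_prod: "finite A \<Longrightarrow> sqrt (prod f A) = (\<Prod>i\<in>A. sqrt (f i))"
  by (induction A rule: finite_induct) (auto simp: real_sqrt_mult)

text \<open>The logarithmic argument needs strictly positive sequences, so all sums are truncated to
  the \<open>k\<close> positive singular values of \<open>X\<close>. This changes nothing on the
  left and only lowers the right side.\<close>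

lemma schatten_le_prod:
  fixes X U V W :: "real mat"
  assumes carr: "X \<in> carrier_mat m n" "U \<in> carrier_mat m d" "V \<in> carrier_mat d d" "W \<in> carrier_mat n d"
    and fac: "X = U * V * transpose_mat W" and rk: "vec_space.rank m X \<le> d"
    and p: "0 < p" "0 < p1" "0 < p2" "0 < p3" "1 / p1 + 1 / p2 + 1 / p3 = 1 / p"
  shows "schatten p X \<le> schatten p1 U * schatten p2 V * schatten p3 W"
proof -
  obtain QX x where X: "QX \<in> carrier_mat n n" "transpose_mat QX * QX = 1\<^sub>m n"
    "transpose_mat X * X = QX * mat_diag n x * transpose_mat QX"
    "\<And>i j. i < n \<Longrightarrow> j < n \<Longrightarrow> col (X * QX) i \<bullet> col (X * QX) j = (if i = j then x i else 0)"
    "\<And>i. i < n \<Longrightarrow> 0 \<le> x i" "\<And>i j. i \<le> j \<Longrightarrow> j < n \<Longrightarrow> x j \<le> x i"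
    by (rule gram_spectral[OF carr(1)]) blast
  obtain QU u where U: "QU \<in> carrier_mat d d" "transpose_mat QU * QU = 1\<^sub>m d"
    "QU * transpose_mat QU = 1\<^sub>m d" "transpose_mat U * U = QU * mat_diag d u * transpose_mat QU"
    "\<And>i. i < d \<Longrightarrow> 0 \<le> u i" "\<And>i j. i \<le> j \<Longrightarrow> j < d \<Longrightarrow> u j \<le> u i"
    by (rule gram_spectral[OF carr(2)]) blast
  obtain QV v where V: "QV \<in> carrier_mat d d" "transpose_mat QV * QV = 1\<^sub>m d"
    "QV * transpose_mat QV = 1\<^sub>m d" "transpose_mat V * V = QV * mat_diag d v * transpose_mat QV"
    "\<And>i. i < d \<Longrightarrow> 0 \<le> v i" "\<And>i j. i \<le> j \<Longrightarrow> j < d \<Longrightarrow> v j \<le> v i"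
    by (rule gram_spectral[OF carr(3)]) blast
  \<comment> \<open>Horn's inequality uses the Gram matrix of \<open>transpose_mat W\<close>;
    invariance under transposition brings back \<open>W\<close> at the end.\<close>
  have Wt: "transpose_mat W \<in> carrier_mat d n" using carr(4) by simp
  obtain QW w where W: "QW \<in> carrier_mat n n" "transpose_mat QW * QW = 1\<^sub>m n"
    "QW * transpose_mat QW = 1\<^sub>m n"
    "transpose_mat (transpose_mat W) * transpose_mat W = QW * mat_diag n w * transpose_mat QW"
    "\<And>i. i < n \<Longrightarrow> 0 \<le> w i" "\<And>i j. i \<le> j \<Longrightarrow> j < n \<Longrightarrow> w j \<le> w i"
    by (rule gram_spectral[OF Wt]) blast
  obtain k where k: "k \<le> n" "\<And>i. i < k \<Longrightarrow> 0 < x i" "\<And>i. k \<le> i \<Longrightarrow> i < n \<Longrightarrow> x i = 0"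
    using antimono_nonneg_support[of n x] X(5,6) by blast
  have kd: "k \<le> d"
    using positive_singular_values_le_rank[OF carr(1) X(1,4) k(1,2)] rk by simp
  have horn: "(\<Prod>i<j. x i) \<le> (\<Prod>i<j. u i * v i * w i)" if "j \<le> k" for j
    by (rule singular_values_prod_le[OF carr fac X(1,2,4) U(1,3-6) V(1,3-6) W(1,3) _ W(5,6)])
      (use W(4) that k(1) kd in auto)
  \<comment> \<open>Horn's inequality at the full index \<open>k\<close> has a positive left side,
    so none of the first \<open>k\<close> singular values of the factors vanishes.\<close>
  have "0 < (\<Prod>i<k. x i)" by (rule prod_pos) (use k(2) in auto)
  then have "(\<Prod>i<k. u i * v i * w i) \<noteq> 0" using horn[OF order_refl] by linarith
  then have "u i \<noteq> 0" "v i \<noteq> 0" "w i \<noteq> 0" if "i < k" for i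
    using that by (auto simp: prod_zero_iff)
  then have pos: "0 < u i" "0 < v i" "0 < w i" if "i < k" for i
    using that U(5)[of i] V(5)[of i] W(5)[of i] k(1) kd by (simp_all add: less_le)
  have part: "(\<Sum>i<k. sqrt (f i) powr q) powr (1 / q) \<le> (\<Sum>i<N. sqrt (f i) powr q) powr (1 / q)"
    if "k \<le> N" "0 < q" for f N q
    by (rule powr_mono2) (use that in \<open>auto intro!: sum_mono2 sum_nonneg\<close>)
  have "schatten p X = (\<Sum>i<n. sqrt (x i) powr p) powr (1 / p)"
    by (rule schatten_eq_sum[OF X(1-3)])
  also have "(\<Sum>i<n. sqrt (x i) powr p) = (\<Sum>i<k. sqrt (x i) powr p)"
    by (rule sum.mono_neutral_right) (use k in auto)
  also have "\<dots> powr (1 / p) \<le> (\<Sum>i<k. sqrt (u i) powr p1) powr (1 / p1)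
      * (\<Sum>i<k. sqrt (v i) powr p2) powr (1 / p2) * (\<Sum>i<k. sqrt (w i) powr p3) powr (1 / p3)"
  proof (rule log_majorization_prod[OF _ _ _ _ _ _ p])
    show "(\<Prod>i<j. sqrt (x i)) \<le> (\<Prod>i<j. sqrt (u i) * sqrt (v i) * sqrt (w i))" if "j \<le> k" for j
      using real_sqrt_le_mono[OF horn[OF that]] by (simp add: sqrt_prod real_sqrt_mult)
    show "sqrt (x j) \<le> sqrt (x i)" if "i \<le> j" "j < k" for i j
      using X(6)[of i j] that k(1) by simp
  qed (use pos k in auto)
  also have "\<dots> \<le> schatten p1 U * schatten p2 V * schatten p3 (transpose_mat W)"
    unfolding schatten_eq_sum[OF U(1,2,4)] schatten_eq_sum[OF V(1,2,4)] schatten_eq_sum[OF W(1,2,4)]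
    by (intro mult_mono part mult_nonneg_nonneg) (use kd k(1) p in auto)
  finally show ?thesis
    unfolding schatten_transpose[OF carr(4)] .
qed

text \<open>Weighted AM-GM with weights \<open>p / p1\<close>, \<open>p / p2\<close>,
  \<open>p / p3\<close>; for positive arguments it is the one-term case of the additive majorization
  bound.\<close>

lemma weighted_am_gm_powr:
  fixes a b c :: real
  assumes nonneg: "0 \<le> a" "0 \<le> b" "0 \<le> c"
    and p: "0 < p" "0 < p1" "0 < p2" "0 < p3" "1 / p1 + 1 / p2 + 1 / p3 = 1 / p"
  shows "a * b * c \<le> ((a powr p1 / p1 + b powr p2 / p2 + c powr p3 / p3) / (1 / p)) powr (1 / p)"
proof (cases "a = 0 \<or> b = 0 \<or> c = 0")
  case True
  then show ?thesis by auto
next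
  case False
  then have pos: "0 < a" "0 < b" "0 < c" using nonneg by auto
  have "(\<Sum>i<(1::nat). (a * b * c) powr p) / p
      \<le> (\<Sum>i<(1::nat). a powr p1) / p1 + (\<Sum>i<(1::nat). b powr p2) / p2 + (\<Sum>i<(1::nat). c powr p3) / p3"
    by (rule log_majorization_sum[OF _ _ _ _ _ _ p]) (use pos in auto)
  then have "(a * b * c) powr p \<le> (a powr p1 / p1 + b powr p2 / p2 + c powr p3 / p3) / (1 / p)"
    using p(1) by (simp add: field_simps)
  then have "((a * b * c) powr p) powr (1 / p)
      \<le> ((a powr p1 / p1 + b powr p2 / p2 + c powr p3 / p3) / (1 / p)) powr (1 / p)"
    using p(1) by (intro powr_mono2) auto
  then show ?thesis using pos p(1) by (simp add: powr_powr)
qed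

section \<open>Attainment\<close>

text \<open>The dimension \<open>d\<close> can be smaller or larger than \<open>n\<close>, so
  diagonal factors with unequal side lengths occur.\<close>

definition rect_diag :: "nat \<Rightarrow> nat \<Rightarrow> (nat \<Rightarrow> 'a :: zero) \<Rightarrow> 'a mat" where
  "rect_diag a b f = mat a b (\<lambda>(i, j). if i = j then f i else 0)"

lemma rect_diag_carrier [simp]: "rect_diag a b f \<in> carrier_mat a b"
  by (simp add: rect_diag_def)

lemma transpose_rect_diag: "transpose_mat (rect_diag a b f) = rect_diag b a f"
  by (rule eq_matI) (auto simp: rect_diag_def)

lemma mat_diag_eq_rect_diag: "mat_diag n f = rect_diag n n f"
  by (rule eq_matI) (auto simp: rect_diag_def mat_diag_def)

lemma rect_diag_mult:
  fixes f g :: "nat \<Rightarrow> 'a :: semiring_1"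
  shows "rect_diag a b f * rect_diag b c g = rect_diag a c (\<lambda>i. if i < b then f i * g i else 0)"
proof (rule eq_matI)
  fix i j assume "i < dim_row (rect_diag a c (\<lambda>i. if i < b then f i * g i else 0))"
    "j < dim_col (rect_diag a c (\<lambda>i. if i < b then f i * g i else 0))"
  then have ij: "i < a" "j < c" by (auto simp: rect_diag_def)
  have "(rect_diag a b f * rect_diag b c g) $$ (i, j)
      = (\<Sum>k<b. (if i = k then f i else 0) * (if k = j then g k else 0))"
    using ij by (simp add: rect_diag_def scalar_prod_def atLeast0LessThan)
  also have "\<dots> = (\<Sum>k<b. if k = i then f i * (if i = j then g i else 0) else 0)"
    by (rule sum.cong) auto
  also have "\<dots> = (if i < b then f i * (if i = j then g i else 0) else 0)"
    by simp
  finally show "(rect_diag a b f * rect_diag b c g) $$ (i, j)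
      = rect_diag a c (\<lambda>i. if i < b then f i * g i else 0) $$ (i, j)"
    using ij by (simp add: rect_diag_def)
qed (auto simp: rect_diag_def)

lemma schatten_diag_gram:
  fixes A :: "real mat"
  assumes A: "transpose_mat A * A = rect_diag d d (\<lambda>i. if i < k then (g i)\<^sup>2 else 0)"
    and g: "\<And>i. i < k \<Longrightarrow> 0 \<le> g i" and k: "k \<le> d"
  shows "schatten q A = (\<Sum>i<k. g i powr q) powr (1 / q)"
proof -
  let ?l = "\<lambda>i. if i < k then (g i)\<^sup>2 else 0"
  have "transpose_mat A * A = 1\<^sub>m d * mat_diag d ?l * transpose_mat (1\<^sub>m d)"
    unfolding A mat_diag_eq_rect_diag
    by (simp add: left_mult_one_mat[OF rect_diag_carrier] right_mult_one_mat[OF rect_diag_carrier])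
  then have "schatten q A = (\<Sum>i<d. sqrt (?l i) powr q) powr (1 / q)"
    by (intro schatten_eq_sum[of "1\<^sub>m d"]) auto
  also have "(\<Sum>i<d. sqrt (?l i) powr q) = (\<Sum>i<k. sqrt (?l i) powr q)"
    by (rule sum.mono_neutral_right) (use k in auto)
  also have "\<dots> = (\<Sum>i<k. g i powr q)"
    by (rule sum.cong) (use g in auto)
  finally show ?thesis .
qed

text \<open>From a singular value decomposition, \<open>\<sigma>\<close> is distributed over the three factors as
  \<open>\<sigma> powr (p / p1)\<close>, \<open>\<sigma> powr (p / p2)\<close> and \<open>\<sigma> powr (p / p3)\<close>; the exponent of \<open>U\<close> is lowered by
  one because \<open>X * Q\<close> already carries a factor \<open>\<sigma>\<close>.\<close>

lemma balanced_factorization_exists: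
  fixes X :: "real mat"
  assumes X: "X \<in> carrier_mat m n" and rk: "vec_space.rank m X \<le> d"
    and p: "0 < p" "0 < p1" "0 < p2" "0 < p3" "1 / p1 + 1 / p2 + 1 / p3 = 1 / p"
  obtains U V W S where "U \<in> carrier_mat m d" "V \<in> carrier_mat d d" "W \<in> carrier_mat n d"
    "X = U * V * transpose_mat W" "0 \<le> S" "schatten p X = S powr (1 / p)"
    "schatten p1 U = S powr (1 / p1)" "schatten p2 V = S powr (1 / p2)" "schatten p3 W = S powr (1 / p3)"
proof -
  obtain Q l where Q: "Q \<in> carrier_mat n n" "transpose_mat Q * Q = 1\<^sub>m n" "Q * transpose_mat Q = 1\<^sub>m n"
    "transpose_mat X * X = Q * mat_diag n l * transpose_mat Q"
    and cols: "\<And>i j. i < n \<Longrightarrow> j < n \<Longrightarrow> col (X * Q) i \<bullet> col (X * Q) j = (if i = j then l i else 0)"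
    and l: "\<And>i. i < n \<Longrightarrow> 0 \<le> l i" "\<And>i j. i \<le> j \<Longrightarrow> j < n \<Longrightarrow> l j \<le> l i"
    by (rule gram_spectral[OF X]) blast
  obtain k where k: "k \<le> n" "\<And>i. i < k \<Longrightarrow> 0 < l i" "\<And>i. k \<le> i \<Longrightarrow> i < n \<Longrightarrow> l i = 0"
    using antimono_nonneg_support[of n l] l by blast
  have kd: "k \<le> d"
    using positive_singular_values_le_rank[OF X Q(1) cols k(1,2)] rk by simp
  define s where "s i = sqrt (l i)" for i
  have s: "0 < s i" "l i = (s i)\<^sup>2" if "i < k" for i
    using k(2)[OF that] by (auto simp: s_def)
  \<comment> \<open>The \<open>p\<close>-th power of the quasi-norm of \<open>X\<close>; each factor
    is built so that the power of its norm belonging to its own exponent equals this same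
    number.\<close>
  define S where "S = (\<Sum>i<k. s i powr p)"
  \<comment> \<open>Cutting diagonals off at \<open>k\<close>, which is at most \<open>n\<close> and
    \<open>d\<close>, keeps only positive \<open>s i\<close> and makes the truncation in
    \<open>rect_diag_mult\<close> harmless.\<close>
  define e where "e f = (\<lambda>i. if i < k then f i else 0)" for f :: "nat \<Rightarrow> real"
  define Y where "Y = X * Q"
  define EU where "EU = rect_diag n d (e (\<lambda>i. s i powr (p / p1 - 1)))"
  define V where "V = rect_diag d d (e (\<lambda>i. s i powr (p / p2)))"
  define EW where "EW = rect_diag n d (e (\<lambda>i. s i powr (p / p3)))"
  have E: "EU \<in> carrier_mat n d" "V \<in> carrier_mat d d" "EW \<in> carrier_mat n d"
    by (simp_all add: EU_def V_def EW_def)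
  have Y: "Y \<in> carrier_mat m n" using X Q(1) by (simp add: Y_def)
  have Yt: "transpose_mat Y \<in> carrier_mat n m" and Qt: "transpose_mat Q \<in> carrier_mat n n"
    and Et: "transpose_mat EU \<in> carrier_mat d n" "transpose_mat EW \<in> carrier_mat d n"
    using Y Q E by auto
  have YY: "transpose_mat Y * Y = rect_diag n n l"
    by (rule eq_matI) (use Y cols in \<open>auto simp: rect_diag_def Y_def[symmetric]\<close>)
  have gram_mult: "transpose_mat (M * N) * (M * N) = transpose_mat N * (transpose_mat M * M) * N"
    if M: "M \<in> carrier_mat a b" and N: "N \<in> carrier_mat b c" for M N :: "real mat" and a b c
  proof -
    have Mt: "transpose_mat M \<in> carrier_mat b a" and Nt: "transpose_mat N \<in> carrier_mat c b"
      using M N by auto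
    show ?thesis
      using transpose_mult[OF M N] assoc_mult_mat[OF Nt Mt mult_carrier_mat[OF M N]]
        assoc_mult_mat[OF Mt M N] assoc_mult_mat[OF Nt mult_carrier_mat[OF Mt M] N] by simp
  qed
  have norm: "schatten q A = S powr (1 / q)"
    if "transpose_mat A * A = rect_diag d d (e (\<lambda>i. (s i powr (p / q))\<^sup>2))" "0 < q" for A q
  proof -
    have "schatten q A = (\<Sum>i<k. (s i powr (p / q)) powr q) powr (1 / q)"
      by (rule schatten_diag_gram[OF that(1)[unfolded e_def] _ kd]) simp
    also have "(\<Sum>i<k. (s i powr (p / q)) powr q) = S"
      unfolding S_def by (rule sum.cong) (use that in \<open>auto simp: powr_powr\<close>)
    finally show ?thesis .
  qed
  have "transpose_mat (Y * EU) * (Y * EU) = rect_diag d d (e (\<lambda>i. (s i powr (p / p1))\<^sup>2))"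
  proof -
    have "s i powr (p / p1 - 1) * (s i)\<^sup>2 * s i powr (p / p1 - 1) = (s i powr (p / p1))\<^sup>2"
      if "i < k" for i
      using s(1)[OF that] by (simp add: powr_diff power2_eq_square field_simps)
    then show ?thesis
      unfolding gram_mult[OF Y E(1)] YY
      unfolding EU_def transpose_rect_diag rect_diag_mult
      by (intro arg_cong[of _ _ "rect_diag d d"] ext) (use k(1) s(2) in \<open>auto simp: e_def\<close>)
  qed
  then have nU: "schatten p1 (Y * EU) = S powr (1 / p1)" using p by (intro norm)
  have "transpose_mat V * V = rect_diag d d (e (\<lambda>i. (s i powr (p / p2))\<^sup>2))"
    unfolding V_def transpose_rect_diag rect_diag_mult
    by (intro arg_cong[of _ _ "rect_diag d d"] ext) (use kd in \<open>auto simp: e_def power2_eq_square\<close>)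
  then have nV: "schatten p2 V = S powr (1 / p2)" using p by (intro norm)
  have "transpose_mat (Q * EW) * (Q * EW) = rect_diag d d (e (\<lambda>i. (s i powr (p / p3))\<^sup>2))"
    unfolding gram_mult[OF Q(1) E(3)] Q(2) right_mult_one_mat[OF Et(2)]
    unfolding EW_def transpose_rect_diag rect_diag_mult
    by (intro arg_cong[of _ _ "rect_diag d d"] ext) (use k(1) in \<open>auto simp: e_def power2_eq_square\<close>)
  then have nW: "schatten p3 (Q * EW) = S powr (1 / p3)" using p by (intro norm)
  have "schatten p X = (\<Sum>i<n. s i powr p) powr (1 / p)"
    unfolding s_def by (rule schatten_eq_sum[OF Q(1,2,4)])
  also have "(\<Sum>i<n. s i powr p) = S"
    unfolding S_def by (rule sum.mono_neutral_right) (use k in \<open>auto simp: s_def\<close>)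
  finally have nX: "schatten p X = S powr (1 / p)" .
  \<comment> \<open>The three exponents add up to \<open>p * (1 / p) - 1 = 0\<close>, so the
    diagonal factors multiply to the projection onto the first \<open>k\<close> coordinates.\<close>
  have one: "s i powr (p / p1 - 1) * s i powr (p / p2) * s i powr (p / p3) = 1" if "i < k" for i
  proof -
    have "p / p1 + p / p2 + p / p3 = p * (1 / p1 + 1 / p2 + 1 / p3)" by (simp add: algebra_simps)
    also have "\<dots> = 1" using p by (simp only: p(5)) simp
    finally have "p / p1 - 1 + p / p2 + p / p3 = 0" by simp
    then show ?thesis using s(1)[OF that] by (simp add: powr_add[symmetric])
  qed
  have core: "EU * V * transpose_mat EW = mat_diag n (e (\<lambda>_. 1))"
    unfolding EU_def V_def EW_def transpose_rect_diag rect_diag_mult mat_diag_eq_rect_diag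
    by (intro arg_cong[of _ _ "rect_diag n n"] ext) (use kd one in \<open>auto simp: e_def\<close>)
  \<comment> \<open>Columns of \<open>Y\<close> from \<open>k\<close> on have length 0, so this
    projection fixes \<open>Y\<close>, and \<open>Y * transpose_mat Q\<close> gives back
    \<open>X\<close>.\<close>
  have "Y $$ (i, j) = 0" if "k \<le> j" "i < m" "j < n" for i j
  proof -
    have "col Y j \<bullet> col Y j = 0" using cols[of j j] that k(3)[of j] by (simp add: Y_def)
    then have "col Y j = 0\<^sub>v m"
      by (subst (asm) scalar_prod_self_eq_0_iff[of _ m]) (use Y in auto)
    from arg_cong[OF this, of "\<lambda>v. v $ i"] show ?thesis using that Y by simp
  qed
  then have Ycore: "Y * mat_diag n (e (\<lambda>_. 1)) = Y"
    unfolding mat_diag_mult_right[OF Y] by (intro eq_matI) (use Y in \<open>auto simp: e_def\<close>)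
  have "Y * EU * V * transpose_mat (Q * EW) = Y * (EU * V * transpose_mat EW) * transpose_mat Q"
    using transpose_mult[OF Q(1) E(3)] assoc_mult_mat[OF Y E(1,2)]
      assoc_mult_mat[OF Y mult_carrier_mat[OF E(1,2)] Et(2)]
      assoc_mult_mat[OF mult_carrier_mat[OF Y mult_carrier_mat[OF E(1,2)]] Et(2) Qt] by simp
  also have "\<dots> = X"
    unfolding core Ycore unfolding Y_def
    using assoc_mult_mat[OF X Q(1) Qt] Q(3) X by simp
  finally have fac: "X = Y * EU * V * transpose_mat (Q * EW)" ..
  show ?thesis
    by (rule that[OF _ E(2) _ fac _ nX nU nV nW]) (use Y E Q in \<open>auto simp: S_def intro!: sum_nonneg\<close>)
qed

section \<open>The three minimum formulas\<close>

theorem theorem4: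
  fixes m n d r :: nat and X :: "real mat" and p p1 p2 p3 :: real
  assumes X: "X \<in> carrier_mat m n"
    and rk: "vec_space.rank m X = r" and rd: "r \<le> d"
    and p: "0 < p" "p \<le> 1"
    and pi: "0 < p1" "0 < p2" "0 < p3"
    and hp: "1 / p1 + 1 / p2 + 1 / p3 = 1 / p"
  defines "F \<equiv> {(U, V, W). U \<in> carrier_mat m d \<and> V \<in> carrier_mat d d \<and>
                   W \<in> carrier_mat n d \<and> X = U * V * transpose_mat W}"
    and "f1 \<equiv> (\<lambda>(U, V, W). schatten p1 U * schatten p2 V * schatten p3 W)"
    and "f2 \<equiv> (\<lambda>(U, V, W).
           ((p2 * p3 * schatten p1 U powr p1 + p1 * p3 * schatten p2 V powr p2
             + p1 * p2 * schatten p3 W powr p3) / (p2 * p3 + p1 * p3 + p1 * p2)) powr (1 / p))"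
    and "f3 \<equiv> (\<lambda>(U, V, W).
           ((schatten p1 U powr p1 / p1 + schatten p2 V powr p2 / p2
             + schatten p3 W powr p3 / p3) / (1 / p)) powr (1 / p))"
  shows "(\<forall>t\<in>F. schatten p X \<le> f1 t) \<and> (\<exists>t\<in>F. f1 t = schatten p X)
       \<and> (\<forall>t\<in>F. schatten p X \<le> f2 t) \<and> (\<exists>t\<in>F. f2 t = schatten p X)
       \<and> (\<forall>t\<in>F. schatten p X \<le> f3 t) \<and> (\<exists>t\<in>F. f3 t = schatten p X)"
proof -
  note exps = p(1) pi hp
  have rank: "vec_space.rank m X \<le> d" using rk rd by simp
  have lower1: "schatten p X \<le> f1 t" if "t \<in> F" for t
    using that schatten_le_prod[OF X _ _ _ _ rank exps] unfolding F_def f1_def by auto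
  have f13: "f1 t \<le> f3 t" for t
    unfolding f1_def f3_def
    using weighted_am_gm_powr[OF schatten_nonneg schatten_nonneg schatten_nonneg exps]
    by (auto split: prod.split)
  \<comment> \<open>Expanding the fraction in \<open>f3\<close> by \<open>p1 * p2 * p3\<close> gives
    the one in \<open>f2\<close>; the denominators match by \<open>hp\<close>, as the instance with
    all three values equal to 1.\<close>
  have f23: "f2 = f3"
  proof -
    have "(p2 * p3 * a + p1 * p3 * b + p1 * p2 * c) / (p2 * p3 + p1 * p3 + p1 * p2)
        = (a / p1 + b / p2 + c / p3) / (1 / p)" for a b c
    proof -
      have num: "p2 * p3 * a + p1 * p3 * b + p1 * p2 * c = (p1 * p2 * p3) * (a / p1 + b / p2 + c / p3)"
        for a b c using pi by (simp add: field_simps)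
      show ?thesis
        unfolding hp[symmetric] num using num[of 1 1 1] pi by simp
    qed
    then show ?thesis unfolding f2_def f3_def by simp
  qed
  \<comment> \<open>In the balanced factorization the three powers in \<open>f3\<close> all equal
    \<open>S\<close>, the equality case of AM-GM, so one triple attains all three minima.\<close>
  obtain U V W S where carr: "U \<in> carrier_mat m d" "V \<in> carrier_mat d d" "W \<in> carrier_mat n d"
      and fac: "X = U * V * transpose_mat W" and S: "0 \<le> S" "schatten p X = S powr (1 / p)"
        "schatten p1 U = S powr (1 / p1)" "schatten p2 V = S powr (1 / p2)" "schatten p3 W = S powr (1 / p3)"
    by (rule balanced_factorization_exists[OF X rank exps])
  let ?t = "(U, V, W)"
  have F: "?t \<in> F" using carr fac by (simp add: F_def)
  have at1: "f1 ?t = schatten p X"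
    unfolding f1_def by (simp add: S hp[symmetric] powr_add)
  have "S / p1 + S / p2 + S / p3 = S * (1 / p1 + 1 / p2 + 1 / p3)" by (simp add: algebra_simps)
  then have "(S / p1 + S / p2 + S / p3) / (1 / p) = S" using p by (simp add: hp)
  then have at3: "f3 ?t = schatten p X"
    unfolding f3_def using S(1) pi by (simp add: S powr_powr)
  show ?thesis
    unfolding f23 using lower1 f13 F at1 at3 by (metis order_trans)
qed

end
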